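(* Let $\mathcal{H}$ be a complex separable Hilbert space and let $A$ be a bounded, self-adjoint, injective, non-invertible operator on $\mathcal{H}$, so that $A^{-1}$ with domain $\mathrm{Ran}\, A$ is a densely defined self-adjoint operator. Then $A$ is Hankel with respect to an isometry $V$ whose pure part $V_0$ has multiplicity $N$ if and only if there is a closed, symmetric restriction $\widetilde{A}_0$ of $A^{-1}$ with dense domain in $\mathcal{H}$ and equal deficiency indices $(N,N)$, i.e. $\dim (\mathrm{Ran}(\widetilde{A}_0 \pm iI))^\perp = N$, such that $\mathrm{Ran}\, \widetilde{A}_0 = \mathrm{Ran}\, V$. Namely: (i) if $V$ is an isometry with pure part of multiplicity $N$ such that $A$ is $V$-Hankel, then $\widetilde{A}_0 := A^{-1}|_{\mathrm{Ran}\, AV}$ is a closed, symmetric restriction of $A^{-1}$ with deficiency indices $(N,N)$; (ii) if $\widetilde{A}_0$ is a closed, symmetric restriction of $A^{-1}$ with dense domain in $\mathcal{H}$ and deficiency indices $(N,N)$, then the isometry $V$ appearing in the polar decomposition of $\widetilde{A}_0$ has pure part of multiplicity $N$ and $A$ is $V$-Hankel. Furthermore, if $\widetilde{A}_0$ is simple and $N > 0$ then $V$ is pure; conversely, if $V$ is pure and $V^*A = AV > 0$, then $\widetilde{A}_0$ is simple.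
   Context: For an isometry $V$, a bounded $A$ is $V$-Hankel if $V^*A = AV$. By the Wold decomposition any isometry $V$ on a separable Hilbert space decomposes as $V = V_0 \oplus U$ with $V_0$ pure (unitarily equivalent to the unilateral shift on $H^2 \otimes \mathbb{C}^n$) and $U$ unitary; $V_0$ is the pure part and its multiplicity is $n = \dim(\mathrm{Ran}\, V)^\perp$. $T>0$ means $T$ is positive semi-definite and injective. A restriction $T_1 \subseteq T_2$ means $\mathrm{Dom}\, T_1 \subseteq \mathrm{Dom}\, T_2$ and $T_1 = T_2|_{\mathrm{Dom}\, T_1}$. The deficiency indices of a closed symmetric operator $T$ are $(n_+, n_-)$ with $n_\pm = \dim(\mathrm{Ran}(T \pm iI))^\perp$. A symmetric operator $T$ on $\mathcal{H}$ is simple if there is no non-trivial closed subspace $\mathcal{J}\subseteq\mathcal{H}$ and dense linear subspace $\mathscr{D}\subseteq\mathcal{J}$, $\mathscr{D}\subseteq\mathrm{Dom}\,T$, with $T\mathscr{D}\subseteq\mathcal{J}$ such that $T|_{\mathscr{D}}$ is self-adjoint as an operator in $\mathcal{J}$. *)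

theory Defs
  imports Complex_Main "HOL-Library.Extended_Nat"
begin

class complex_vector = ab_group_add +
  fixes scaleC :: "complex \<Rightarrow> 'a \<Rightarrow> 'a" (infixr "*\<^sub>C" 75)
  assumes scaleC_add_right: "a *\<^sub>C (x + y) = a *\<^sub>C x + a *\<^sub>C y"
    and scaleC_add_left: "(a + b) *\<^sub>C x = a *\<^sub>C x + b *\<^sub>C x"
    and scaleC_scaleC: "a *\<^sub>C (b *\<^sub>C x) = (a * b) *\<^sub>C x"
    and scaleC_one: "1 *\<^sub>C x = x"

class complex_inner = complex_vector +
  fixes cinner :: "'a \<Rightarrow> 'a \<Rightarrow> complex"
  assumes cinner_conj: "cinner x y = cnj (cinner y x)"
    and cinner_add_right: "cinner x (y + z) = cinner x y + cinner x z"
    and cinner_scaleC_right: "cinner x (a *\<^sub>C y) = a * cinner x y"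
    and cinner_ge_zero: "Re (cinner x x) \<ge> 0"
    and cinner_eq_zero_iff: "cinner x x = 0 \<longleftrightarrow> x = 0"

definition cnorm :: "'a::complex_inner \<Rightarrow> real" where
  "cnorm x = sqrt (Re (cinner x x))"

class chilbert_space = complex_inner +
  assumes cauchy_converges:
    "(\<forall>e>0. \<exists>M. \<forall>m\<ge>M. \<forall>n\<ge>M. sqrt (Re (cinner (X m - X n) (X m - X n))) < e)
      \<Longrightarrow> \<exists>L. (\<lambda>n. sqrt (Re (cinner (X n - L) (X n - L)))) \<longlonglongrightarrow> 0"

definition cdense_in :: "'a::complex_inner set \<Rightarrow> 'a set \<Rightarrow> bool" where
  "cdense_in D J \<longleftrightarrow> (\<forall>x\<in>J. \<forall>e>0. \<exists>y\<in>D. cnorm (x - y) < e)"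

abbreviation cdense :: "'a::complex_inner set \<Rightarrow> bool" where
  "cdense D \<equiv> cdense_in D UNIV"

definition cseparable :: "'a::complex_inner itself \<Rightarrow> bool" where
  "cseparable _ \<longleftrightarrow> (\<exists>S::'a set. countable S \<and> cdense S)"

definition cclosed :: "'a::complex_inner set \<Rightarrow> bool" where
  "cclosed S \<longleftrightarrow> (\<forall>X L. (\<forall>n. X n \<in> S) \<longrightarrow> (\<lambda>n. cnorm (X n - L)) \<longlonglongrightarrow> 0 \<longrightarrow> L \<in> S)"

definition csubspace :: "'a::complex_vector set \<Rightarrow> bool" where
  "csubspace S \<longleftrightarrow> 0 \<in> S \<and> (\<forall>x\<in>S. \<forall>y\<in>S. x + y \<in> S) \<and> (\<forall>c. \<forall>x\<in>S. c *\<^sub>C x \<in> S)"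

definition orth_compl :: "'a::complex_inner set \<Rightarrow> 'a set" where
  "orth_compl S = {y. \<forall>x\<in>S. cinner x y = 0}"

definition orthonormal :: "'a::complex_inner set \<Rightarrow> bool" where
  "orthonormal B \<longleftrightarrow> (\<forall>x\<in>B. cinner x x = 1) \<and> (\<forall>x\<in>B. \<forall>y\<in>B. x \<noteq> y \<longrightarrow> cinner x y = 0)"

text \<open>(Hilbert) dimension of a subspace, in \<open>{0,1,...,\<infinity>}\<close>: the supremum of the sizes
  of finite orthonormal subsets (for separable spaces this is the Hilbert dimension).\<close>
definition hdim :: "'a::complex_inner set \<Rightarrow> enat" where
  "hdim S = Sup {enat (card B) | B. finite B \<and> B \<subseteq> S \<and> orthonormal B}"

definition bounded_clinear :: "('a::complex_inner \<Rightarrow> 'b::complex_inner) \<Rightarrow> bool" where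
  "bounded_clinear f \<longleftrightarrow> (\<forall>x y. f (x + y) = f x + f y) \<and> (\<forall>c x. f (c *\<^sub>C x) = c *\<^sub>C f x)
     \<and> (\<exists>K. \<forall>x. cnorm (f x) \<le> K * cnorm x)"

definition cadj :: "('a::complex_inner \<Rightarrow> 'a) \<Rightarrow> ('a \<Rightarrow> 'a)" where
  "cadj A = (SOME B. \<forall>x y. cinner (A x) y = cinner x (B y))"

definition cinvertible :: "('a::complex_inner \<Rightarrow> 'a) \<Rightarrow> bool" where
  "cinvertible A \<longleftrightarrow> (\<exists>B. bounded_clinear B \<and> A \<circ> B = id \<and> B \<circ> A = id)"

definition is_isometry :: "('a::complex_inner \<Rightarrow> 'a) \<Rightarrow> bool" where
  "is_isometry V \<longleftrightarrow> bounded_clinear V \<and> (\<forall>x. cnorm (V x) = cnorm x)"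

definition partial_isometry :: "('a::complex_inner \<Rightarrow> 'a) \<Rightarrow> bool" where
  "partial_isometry V \<longleftrightarrow> bounded_clinear V \<and>
     (\<forall>x\<in>orth_compl {y. V y = 0}. cnorm (V x) = cnorm x)"

definition hankel :: "('a::complex_inner \<Rightarrow> 'a) \<Rightarrow> ('a \<Rightarrow> 'a) \<Rightarrow> bool" where
  "hankel V A \<longleftrightarrow> cadj V \<circ> A = A \<circ> V"

definition pure_mult :: "('a::complex_inner \<Rightarrow> 'a) \<Rightarrow> enat" where
  "pure_mult V = hdim (orth_compl (range V))"

text \<open>An isometry is pure iff its unitary part in the Wold decomposition is trivial,
  i.e. \<open>\<Inter>\<^sub>n Ran V\<^sup>n = {0}\<close>.\<close>
definition is_pure :: "('a::complex_inner \<Rightarrow> 'a) \<Rightarrow> bool" where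
  "is_pure V \<longleftrightarrow> (\<Inter>n. range (V ^^ n)) = {0}"

definition strictly_pos :: "('a::complex_inner \<Rightarrow> 'a) \<Rightarrow> bool" where
  "strictly_pos T \<longleftrightarrow> (\<forall>x. cinner x (T x) \<in> \<real> \<and> Re (cinner x (T x)) \<ge> 0) \<and> inj T"

definition op_restriction :: "'a set \<Rightarrow> ('a \<Rightarrow> 'b) \<Rightarrow> 'a set \<Rightarrow> ('a \<Rightarrow> 'b) \<Rightarrow> bool" where
  "op_restriction D1 T1 D2 T2 \<longleftrightarrow> D1 \<subseteq> D2 \<and> (\<forall>x\<in>D1. T1 x = T2 x)"

definition op_closed :: "'a::complex_inner set \<Rightarrow> ('a \<Rightarrow> 'a) \<Rightarrow> bool" where
  "op_closed D T \<longleftrightarrow> (\<forall>X x y. (\<forall>n. X n \<in> D) \<longrightarrow> (\<lambda>n. cnorm (X n - x)) \<longlonglongrightarrow> 0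
      \<longrightarrow> (\<lambda>n. cnorm (T (X n) - y)) \<longlonglongrightarrow> 0 \<longrightarrow> x \<in> D \<and> T x = y)"

definition op_symmetric :: "'a::complex_inner set \<Rightarrow> ('a \<Rightarrow> 'a) \<Rightarrow> bool" where
  "op_symmetric D T \<longleftrightarrow> (\<forall>x\<in>D. \<forall>y\<in>D. cinner (T x) y = cinner x (T y))"

definition def_plus :: "'a::complex_inner set \<Rightarrow> ('a \<Rightarrow> 'a) \<Rightarrow> enat" where
  "def_plus D T = hdim (orth_compl ((\<lambda>x. T x + \<i> *\<^sub>C x) ` D))"

definition def_minus :: "'a::complex_inner set \<Rightarrow> ('a \<Rightarrow> 'a) \<Rightarrow> enat" where
  "def_minus D T = hdim (orth_compl ((\<lambda>x. T x - \<i> *\<^sub>C x) ` D))"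

text \<open>\<open>T\<close> with domain \<open>D\<close> is a self-adjoint operator in the closed subspace \<open>J\<close>:
  densely defined in \<open>J\<close>, maps into \<open>J\<close>, symmetric, and the domain of its adjoint
  (computed in \<open>J\<close>) is contained in \<open>D\<close>.\<close>
definition op_selfadjoint_in :: "'a::complex_inner set \<Rightarrow> 'a set \<Rightarrow> ('a \<Rightarrow> 'a) \<Rightarrow> bool" where
  "op_selfadjoint_in J D T \<longleftrightarrow> csubspace D \<and> D \<subseteq> J \<and> cdense_in D J \<and> T ` D \<subseteq> J
     \<and> (\<forall>x\<in>D. \<forall>y\<in>D. T (x + y) = T x + T y) \<and> (\<forall>c. \<forall>x\<in>D. T (c *\<^sub>C x) = c *\<^sub>C T x)
     \<and> op_symmetric D T
     \<and> (\<forall>y\<in>J. (\<exists>z\<in>J. \<forall>x\<in>D. cinner (T x) y = cinner x z) \<longrightarrow> y \<in> D)"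

abbreviation op_selfadjoint :: "'a::complex_inner set \<Rightarrow> ('a \<Rightarrow> 'a) \<Rightarrow> bool" where
  "op_selfadjoint D T \<equiv> op_selfadjoint_in UNIV D T"

definition op_positive :: "'a::complex_inner set \<Rightarrow> ('a \<Rightarrow> 'a) \<Rightarrow> bool" where
  "op_positive D T \<longleftrightarrow> (\<forall>x\<in>D. cinner x (T x) \<in> \<real> \<and> Re (cinner x (T x)) \<ge> 0)"

definition op_simple :: "'a::complex_inner set \<Rightarrow> ('a \<Rightarrow> 'a) \<Rightarrow> bool" where
  "op_simple D T \<longleftrightarrow> \<not> (\<exists>J E. csubspace J \<and> cclosed J \<and> J \<noteq> {0} \<and>
        E \<subseteq> D \<and> op_selfadjoint_in J E T)"

text \<open>\<open>V\<close> is the partial isometry in the polar decomposition \<open>T = V |T|\<close>: \<open>V\<close> is a partial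
  isometry with \<open>ker V = ker T\<close>, and \<open>T = V P\<close> for a positive self-adjoint \<open>P\<close> with
  \<open>Dom P = Dom T\<close> (necessarily \<open>P = |T|\<close>).\<close>
definition polar_part :: "'a::complex_inner set \<Rightarrow> ('a \<Rightarrow> 'a) \<Rightarrow> ('a \<Rightarrow> 'a) \<Rightarrow> bool" where
  "polar_part D T V \<longleftrightarrow> partial_isometry V \<and> {x. V x = 0} = {x\<in>D. T x = 0}
     \<and> (\<exists>P. op_selfadjoint D P \<and> op_positive D P \<and> (\<forall>x\<in>D. T x = V (P x)))"

end

theory Submission
  imports Defs
begin

text \<open>Write \<open>R\<close> for the range of the restriction \<open>T\<close>, so that \<open>Dom T = A R\<close>. Since
  \<open>Ran (T \<plusminus> \<i>) = (1 \<plusminus> \<i>A) R\<close> and \<open>1 \<plusminus> \<i>A\<close> is bijective, both deficiency indices equal the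
  codimension of \<open>R\<close>. If \<open>A\<close> is \<open>V\<close>-Hankel, then \<open>R = Ran V\<close> gives a closed densely defined
  restriction. Conversely, if \<open>T = V P\<close> is a polar decomposition, then \<open>P\<close> is bounded below and
  self-adjoint, hence onto, and \<open>A V = P\<^sup>-\<^sup>1\<close> is bounded, self-adjoint and positive, which is the
  Hankel property.

  If moreover \<open>A V \<ge> 0\<close>, then \<open>V\<^sup>2 = 1\<close> on the unitary part \<open>J\<close> of \<open>V\<close>, so \<open>J = ker (V\<^sup>2 - 1)\<close> is
  invariant under \<open>A\<close> and \<open>(A|J)\<^sup>-\<^sup>1\<close> is a self-adjoint part of \<open>T\<close>. Conversely, a self-adjoint part
  of \<open>T\<close> in \<open>J\<close> satisfies \<open>A J \<subseteq> J \<subseteq> Ran V\<close>, so \<open>(A V)\<^sup>2 = A\<^sup>2\<close> on \<open>J\<close>; uniqueness of positive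
  square roots makes \<open>J\<close> invariant under \<open>A V\<close>, and then \<open>J \<subseteq> V J\<close>.\<close>

section \<open>Linear algebra over the complex scalars\<close>

interpretation cvs: vector_space "scaleC :: complex \<Rightarrow> 'a \<Rightarrow> 'a::complex_vector"
  by unfold_locales (simp_all add: scaleC_add_right scaleC_add_left scaleC_scaleC scaleC_one)

subsection \<open>Inner products and norms\<close>

lemma cinner_add_left: "cinner (x + y) z = cinner x z + cinner y z"
  by (metis cinner_conj cinner_add_right complex_cnj_add)

lemma cinner_scaleC_left: "cinner (a *\<^sub>C x) y = cnj a * cinner x y"
  by (metis cinner_conj cinner_scaleC_right complex_cnj_mult)

lemma cinner_zero_right [simp]: "cinner x 0 = 0"
  using cinner_add_right[of x 0 0] by simp

lemma cinner_zero_left [simp]: "cinner 0 x = 0"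
  using cinner_add_left[of 0 0 x] by simp

lemma cinner_minus_right: "cinner x (- y) = - cinner x y"
  using cinner_add_right[of x y "- y"] by (simp add: eq_neg_iff_add_eq_0 add.commute)

lemma cinner_minus_left: "cinner (- x) y = - cinner x y"
  using cinner_add_left[of x "- x" y] by (simp add: eq_neg_iff_add_eq_0 add.commute)

lemma cinner_diff_right: "cinner x (y - z) = cinner x y - cinner x z"
  using cinner_add_right[of x y "- z"] by (simp add: cinner_minus_right)

lemma cinner_diff_left: "cinner (x - y) z = cinner x z - cinner y z"
  using cinner_add_left[of x "- y" z] by (simp add: cinner_minus_left)

lemmas cinner_simps = cinner_add_left cinner_add_right cinner_diff_left cinner_diff_right
  cinner_minus_left cinner_minus_right cinner_scaleC_left cinner_scaleC_right

lemma cinner_sum_right: "cinner x (sum f S) = (\<Sum>i\<in>S. cinner x (f i))"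
  by (induction S rule: infinite_finite_induct) (simp_all add: cinner_add_right)

lemma cinner_commute_zero: "cinner x y = 0 \<longleftrightarrow> cinner y x = 0"
  by (metis cinner_conj complex_cnj_zero)

lemma Re_cinner_commute: "Re (cinner x y) = Re (cinner y x)"
  by (metis cinner_conj cnj.sel(1))

lemma cnorm_sq: "(cnorm x)\<^sup>2 = Re (cinner x x)"
  by (simp add: cnorm_def cinner_ge_zero)

lemma cinner_self: "cinner x x = complex_of_real ((cnorm x)\<^sup>2)"
proof -
  have "Im (cinner x x) = 0"
    using cinner_conj[of x x] by (metis cnj.sel(2) equal_neg_zero)
  then show ?thesis by (simp add: cnorm_sq complex_eq_iff)
qed

lemma cnorm_ge_zero [simp]: "0 \<le> cnorm x"
  by (simp add: cnorm_def cinner_ge_zero)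

lemma cnorm_eq_zero [simp]: "cnorm x = 0 \<longleftrightarrow> x = 0"
proof
  assume "cnorm x = 0"
  then have "cinner x x = 0" by (simp add: cinner_self)
  then show "x = 0" by (simp add: cinner_eq_zero_iff)
qed (simp add: cnorm_def)

lemma cnorm_zero [simp]: "cnorm 0 = 0"
  by simp

lemma cnorm_scaleC: "cnorm (a *\<^sub>C x) = cmod a * cnorm x"
proof -
  have "complex_of_real ((cnorm (a *\<^sub>C x))\<^sup>2) = complex_of_real ((cmod a * cnorm x)\<^sup>2)"
    using complex_norm_square[of a]
    unfolding cinner_self[symmetric] power_mult_distrib of_real_mult
    by (simp add: cinner_simps mult.assoc mult.left_commute)
  then show ?thesis
    by (metis cnorm_ge_zero mult_nonneg_nonneg norm_ge_zero of_real_eq_iff power2_eq_iff_nonneg)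
qed

lemma cnorm_minus [simp]: "cnorm (- x) = cnorm x"
  by (simp add: cnorm_def cinner_simps)

lemma cnorm_minus_commute: "cnorm (x - y) = cnorm (y - x)"
  by (metis cnorm_minus minus_diff_eq)

lemma cnorm_add_sq: "(cnorm (x + y))\<^sup>2 = (cnorm x)\<^sup>2 + 2 * Re (cinner x y) + (cnorm y)\<^sup>2"
  using Re_cinner_commute[of x y] by (simp add: cnorm_sq cinner_simps)

lemma cnorm_diff_sq: "(cnorm (x - y))\<^sup>2 = (cnorm x)\<^sup>2 - 2 * Re (cinner x y) + (cnorm y)\<^sup>2"
  using Re_cinner_commute[of x y] by (simp add: cnorm_sq cinner_simps)

lemma Cauchy_Schwarz: "cmod (cinner x y) \<le> cnorm x * cnorm y"
proof (cases "x = 0")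
  case False
  define c where "c = cinner x y / cinner x x"
  define w where "w = y - c *\<^sub>C x"
  have nz: "cinner x x \<noteq> 0" using False by (simp add: cinner_eq_zero_iff)
  have "cinner x w = 0" using nz by (simp add: w_def c_def cinner_simps)
  then have "Re (cinner (c *\<^sub>C x) w) = 0" by (simp add: cinner_simps)
  moreover have "y = c *\<^sub>C x + w" by (simp add: w_def)
  ultimately have "(cnorm y)\<^sup>2 = (cnorm (c *\<^sub>C x))\<^sup>2 + (cnorm w)\<^sup>2"
    using cnorm_add_sq[of "c *\<^sub>C x" w] by simp
  then have "(cnorm (c *\<^sub>C x))\<^sup>2 \<le> (cnorm y)\<^sup>2" by simp
  then have "cmod c * cnorm x \<le> cnorm y"
    using power2_le_imp_le[of "cnorm (c *\<^sub>C x)" "cnorm y"] by (simp add: cnorm_scaleC)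
  then have "cnorm x * (cmod c * cnorm x) \<le> cnorm x * cnorm y"
    by (simp add: mult_left_mono)
  moreover have "cinner x y = c * of_real ((cnorm x)\<^sup>2)"
    using nz unfolding cinner_self[symmetric] by (simp add: c_def)
  then have "cmod (cinner x y) = cnorm x * (cmod c * cnorm x)"
    by (simp add: norm_mult power2_eq_square flip: of_real_mult)
  ultimately show ?thesis by simp
qed simp

lemma Re_cinner_le: "Re (cinner x y) \<le> cnorm x * cnorm y"
  using Cauchy_Schwarz[of x y] complex_Re_le_cmod[of "cinner x y"] by linarith

lemma cnorm_triangle: "cnorm (x + y) \<le> cnorm x + cnorm y"
proof (rule power2_le_imp_le)
  show "(cnorm (x + y))\<^sup>2 \<le> (cnorm x + cnorm y)\<^sup>2"
    using Re_cinner_le[of x y] by (simp add: cnorm_add_sq power2_sum)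
qed simp

lemma cnorm_triangle_diff: "cnorm (x - z) \<le> cnorm (x - y) + cnorm (y - z)"
  using cnorm_triangle[of "x - y" "y - z"] by simp

lemma cnorm_abs_diff: "\<bar>cnorm x - cnorm y\<bar> \<le> cnorm (x - y)"
  using cnorm_triangle[of "x - y" y] cnorm_triangle[of "y - x" x] cnorm_minus_commute[of x y]
  by simp

lemma parallelogram_law:
  "(cnorm (x + y))\<^sup>2 + (cnorm (x - y))\<^sup>2 = 2 * (cnorm x)\<^sup>2 + 2 * (cnorm y)\<^sup>2"
  by (simp add: cnorm_add_sq cnorm_diff_sq)

lemma cinner_ext: "(\<And>z. cinner z x = cinner z y) \<Longrightarrow> x = y"
  by (metis cinner_diff_right cinner_eq_zero_iff eq_iff_diff_eq_0)

subsection \<open>Limits\<close>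

text \<open>Norm convergence in exactly the form in which \<open>cclosed\<close> and
  \<open>op_closed\<close> state it, so that both unfold to statements about
  \<open>cconv\<close>.\<close>

abbreviation cconv :: "(nat \<Rightarrow> 'a::complex_inner) \<Rightarrow> 'a \<Rightarrow> bool" where
  "cconv X L \<equiv> (\<lambda>n. cnorm (X n - L)) \<longlonglongrightarrow> 0"

lemma cconv_dominated:
  assumes "f \<longlonglongrightarrow> 0" "\<And>n. cnorm (X n - L) \<le> f n"
  shows "cconv X L"
  using tendsto_sandwich[OF _ _ tendsto_const assms(1), of "\<lambda>n. cnorm (X n - L)"] assms(2) by simp

lemma cconv_const: "cconv (\<lambda>n. L) L"
  by simp

lemma cconv_add: "cconv X L \<Longrightarrow> cconv Y M \<Longrightarrow> cconv (\<lambda>n. X n + Y n) (L + M)"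
proof (rule cconv_dominated)
  assume "cconv X L" "cconv Y M"
  then show "(\<lambda>n. cnorm (X n - L) + cnorm (Y n - M)) \<longlonglongrightarrow> 0"
    using tendsto_add by fastforce
  show "cnorm (X n + Y n - (L + M)) \<le> cnorm (X n - L) + cnorm (Y n - M)" for n
    using cnorm_triangle[of "X n - L" "Y n - M"] by (simp add: algebra_simps)
qed

lemma cconv_unique:
  assumes "cconv X L" "cconv X M" shows "L = M"
proof -
  have "(\<lambda>n. cnorm (X n - L) + cnorm (X n - M)) \<longlonglongrightarrow> 0"
    using tendsto_add[OF assms] by simp
  moreover have "cnorm (L - M) \<le> cnorm (X n - L) + cnorm (X n - M)" for n
    using cnorm_triangle_diff[of L M "X n"] by (simp add: cnorm_minus_commute)
  ultimately have "cnorm (L - M) \<le> 0"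
    by (intro LIMSEQ_le_const) auto
  then show ?thesis using cnorm_ge_zero[of "L - M"] by (metis antisym cnorm_eq_zero right_minus_eq)
qed

lemma cconv_cnorm: 
  assumes "cconv X L" shows "(\<lambda>n. cnorm (X n)) \<longlonglongrightarrow> cnorm L"
proof -
  have "(\<lambda>n. cnorm (X n) - cnorm L) \<longlonglongrightarrow> 0"
    by (rule tendsto_0_le[OF assms, where K = 1]) (simp add: cnorm_abs_diff)
  then show ?thesis by (simp add: LIM_zero_iff)
qed

lemma cconv_cinner_right:
  assumes "cconv X L" shows "(\<lambda>n. cinner z (X n)) \<longlonglongrightarrow> cinner z L"
proof -
  have "(\<lambda>n. cinner z (X n) - cinner z L) \<longlonglongrightarrow> 0"
    by (rule tendsto_0_le[OF assms, where K = "cnorm z"])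
      (simp add: Cauchy_Schwarz mult.commute flip: cinner_diff_right)
  then show ?thesis by (simp add: LIM_zero_iff)
qed

lemma cconv_cinner_left:
  assumes "cconv X L" shows "(\<lambda>n. cinner (X n) z) \<longlonglongrightarrow> cinner L z"
  using tendsto_cnj[OF cconv_cinner_right[OF assms, of z]] by (simp flip: cinner_conj)

definition ccauchy :: "(nat \<Rightarrow> 'a::complex_inner) \<Rightarrow> bool" where
  "ccauchy X \<longleftrightarrow> (\<forall>e>0. \<exists>M. \<forall>m\<ge>M. \<forall>n\<ge>M. cnorm (X m - X n) < e)"

lemma ccauchy_convergent:
  fixes X :: "nat \<Rightarrow> 'a::chilbert_space"
  assumes "ccauchy X" obtains L where "cconv X L"
  using cauchy_converges[of X] assms unfolding ccauchy_def cnorm_def by auto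

lemma cconv_imp_ccauchy:
  assumes "cconv X L" shows "ccauchy X"
  unfolding ccauchy_def
proof (intro allI impI)
  fix e :: real assume "e > 0"
  then obtain M where M: "\<And>n. n \<ge> M \<Longrightarrow> cnorm (X n - L) < e/2"
    using LIMSEQ_D[OF assms, of "e/2"] by auto
  have "cnorm (X m - X n) < e" if "m \<ge> M" "n \<ge> M" for m n
    using M[OF that(1)] M[OF that(2)] cnorm_triangle_diff[of "X m" "X n" L]
    by (simp add: cnorm_minus_commute)
  then show "\<exists>M. \<forall>m\<ge>M. \<forall>n\<ge>M. cnorm (X m - X n) < e" by blast
qed

lemma ccauchy_mono:
  assumes "ccauchy Y" "K \<ge> 0" "\<And>m n. cnorm (X m - X n) \<le> K * cnorm (Y m - Y n)"
  shows "ccauchy X"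
  unfolding ccauchy_def
proof (intro allI impI)
  fix e :: real assume "e > 0"
  then have "e / (K + 1) > 0" using \<open>K \<ge> 0\<close> by simp
  then obtain M where M: "\<And>m n. m \<ge> M \<Longrightarrow> n \<ge> M \<Longrightarrow> cnorm (Y m - Y n) < e / (K+1)"
    using assms(1) unfolding ccauchy_def by blast
  have "cnorm (X m - X n) < e" if "m \<ge> M" "n \<ge> M" for m n
  proof -
    have "cnorm (X m - X n) \<le> (K+1) * cnorm (Y m - Y n)"
      using assms(3)[of m n] cnorm_ge_zero[of "Y m - Y n"] unfolding distrib_right by linarith
    also have "\<dots> < e" using M[OF that] \<open>K \<ge> 0\<close> by (simp add: field_simps)
    finally show ?thesis .
  qed
  then show "\<exists>M. \<forall>m\<ge>M. \<forall>n\<ge>M. cnorm (X m - X n) < e" by blast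
qed

lemma cdense_in_seq:
  assumes "cdense_in D J" "x \<in> J"
  obtains X where "\<And>n. X n \<in> D" "cconv X x"
proof -
  have "\<forall>n. \<exists>y\<in>D. cnorm (x - y) < inverse (real (Suc n))"
    using assms unfolding cdense_in_def by simp
  then obtain X where X: "\<And>n. X n \<in> D" "\<And>n. cnorm (x - X n) < inverse (real (Suc n))"
    by metis
  have "cconv X x"
    using X(2) by (intro cconv_dominated[OF LIMSEQ_inverse_real_of_nat]) (simp add: cnorm_minus_commute less_imp_le)
  with X(1) that show thesis by blast
qed

text \<open>The difference \<open>x - y\<close> lies in \<open>J\<close>, is orthogonal to
  \<open>D\<close> and is a limit of elements of \<open>D\<close>; hence it is orthogonal to
  itself.\<close>

lemma cdense_cinner_eq:
  assumes "cdense_in D J" "x \<in> J" "y \<in> J" "csubspace J" "\<And>z. z \<in> D \<Longrightarrow> cinner z x = cinner z y"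
  shows "x = y"
proof -
  have "x + (-1) *\<^sub>C y \<in> J" using assms(2-4) unfolding csubspace_def by blast
  then have "x - y \<in> J" by simp
  then obtain X where X: "\<And>n. X n \<in> D" "cconv X (x - y)" using cdense_in_seq[OF assms(1)] by metis
  have "(\<lambda>n. cinner (X n) (x - y)) \<longlonglongrightarrow> cinner (x - y) (x - y)"
    by (rule cconv_cinner_left[OF X(2)])
  moreover have "cinner (X n) (x - y) = 0" for n using assms(5)[OF X(1)] by (simp add: cinner_simps)
  ultimately have "cinner (x - y) (x - y) = 0" by (simp add: LIMSEQ_const_iff)
  then show ?thesis by (simp add: cinner_eq_zero_iff)
qed

subsection \<open>Bounded operators\<close>

lemma bounded_clinear_add: "bounded_clinear f \<Longrightarrow> f (x + y) = f x + f y"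
  and bounded_clinear_scaleC: "bounded_clinear f \<Longrightarrow> f (c *\<^sub>C x) = c *\<^sub>C f x"
  by (simp_all add: bounded_clinear_def)

lemma bounded_clinear_zero: "bounded_clinear f \<Longrightarrow> f 0 = 0"
  using bounded_clinear_scaleC[of f 0 0] by simp

lemma bounded_clinear_minus: "bounded_clinear f \<Longrightarrow> f (- x) = - f x"
  using bounded_clinear_scaleC[of f "-1" x] by simp

lemma bounded_clinear_diff: "bounded_clinear f \<Longrightarrow> f (x - y) = f x - f y"
  using bounded_clinear_add[of f x "- y"] by (simp add: bounded_clinear_minus)

lemmas bounded_clinear_simps = bounded_clinear_add bounded_clinear_scaleC bounded_clinear_zero
  bounded_clinear_minus bounded_clinear_diff

lemma bounded_clinear_bound:
  assumes "bounded_clinear f"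
  obtains K where "K > 0" "\<And>x. cnorm (f x) \<le> K * cnorm x"
proof -
  obtain K where K: "\<And>x. cnorm (f x) \<le> K * cnorm x" using assms unfolding bounded_clinear_def by blast
  have "cnorm (f x) \<le> (\<bar>K\<bar> + 1) * cnorm x" for x
    using order_trans[OF K[of x] mult_right_mono[of K "\<bar>K\<bar> + 1" "cnorm x"]] by simp
  then show thesis using that[of "\<bar>K\<bar> + 1"] by simp
qed

lemma bounded_clinearI:
  assumes "\<And>x y. f (x + y) = f x + f y" "\<And>c x. f (c *\<^sub>C x) = c *\<^sub>C f x"
    "\<And>x. cnorm (f x) \<le> K * cnorm x"
  shows "bounded_clinear f"
  using assms unfolding bounded_clinear_def by blast

lemma bounded_clinear_injI:
  assumes "bounded_clinear f" "\<And>x. f x = 0 \<Longrightarrow> x = 0" shows "inj f"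
proof (rule injI)
  fix x y assume "f x = f y"
  then have "x - y = 0" by (intro assms(2)) (simp add: bounded_clinear_diff[OF assms(1)])
  then show "x = y" by simp
qed

lemma bounded_clinear_ident: "bounded_clinear (\<lambda>x. x)"
  by (rule bounded_clinearI[where K = 1]) simp_all

lemma bounded_clinear_compose:
  assumes "bounded_clinear f" "bounded_clinear g" shows "bounded_clinear (\<lambda>x. f (g x))"
proof -
  obtain K L where KL: "K > 0" "\<And>x. cnorm (f x) \<le> K * cnorm x" "L > 0" "\<And>x. cnorm (g x) \<le> L * cnorm x"
    using assms by (metis bounded_clinear_bound)
  show ?thesis
  proof (rule bounded_clinearI[where K = "K * L"])
    show "cnorm (f (g x)) \<le> K * L * cnorm x" for x
      using KL(2)[of "g x"] mult_left_mono[OF KL(4)[of x], of K] KL(1) unfolding mult.assoc by linarith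
  qed (simp_all add: assms bounded_clinear_simps)
qed

lemma bounded_clinear_plus:
  assumes "bounded_clinear f" "bounded_clinear g" shows "bounded_clinear (\<lambda>x. f x + g x)"
proof -
  obtain K L where KL: "\<And>x. cnorm (f x) \<le> K * cnorm x" "\<And>x. cnorm (g x) \<le> L * cnorm x"
    using assms by (metis bounded_clinear_bound)
  show ?thesis
  proof (rule bounded_clinearI[where K = "K + L"])
    show "cnorm (f x + g x) \<le> (K + L) * cnorm x" for x
      using KL(1)[of x] KL(2)[of x] cnorm_triangle[of "f x" "g x"] by (simp add: distrib_right)
  qed (simp_all add: assms bounded_clinear_simps scaleC_add_right)
qed

lemma bounded_clinear_scale:
  assumes "bounded_clinear f" shows "bounded_clinear (\<lambda>x. a *\<^sub>C f x)"
proof -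
  obtain K where K: "\<And>x. cnorm (f x) \<le> K * cnorm x"
    using assms by (metis bounded_clinear_bound)
  show ?thesis
  proof (rule bounded_clinearI[where K = "cmod a * K"])
    show "cnorm (a *\<^sub>C f x) \<le> cmod a * K * cnorm x" for x
      using mult_left_mono[OF K[of x], of "cmod a"] by (simp add: cnorm_scaleC mult.assoc)
  qed (simp_all add: assms bounded_clinear_simps scaleC_add_right mult.commute)
qed

lemma bounded_clinear_sub:
  assumes "bounded_clinear f" "bounded_clinear g" shows "bounded_clinear (\<lambda>x. f x - g x)"
  using bounded_clinear_plus[OF assms(1) bounded_clinear_scale[OF assms(2), of "-1"]] by simp

lemma bounded_clinear_cconv:
  assumes "bounded_clinear f" "cconv X L" shows "cconv (\<lambda>n. f (X n)) (f L)"
proof -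
  obtain K where K: "\<And>x. cnorm (f x) \<le> K * cnorm x"
    using assms(1) by (metis bounded_clinear_bound)
  show ?thesis
    using K tendsto_mult_right_zero[OF assms(2), of K]
    by (intro cconv_dominated) (auto simp flip: bounded_clinear_diff[OF assms(1)])
qed

lemma cconv_scaleC: "cconv X L \<Longrightarrow> cconv (\<lambda>n. a *\<^sub>C X n) (a *\<^sub>C L)"
  by (rule bounded_clinear_cconv[OF bounded_clinear_scale[OF bounded_clinear_ident]])

lemma bounded_clinear_eq_on_dense:
  assumes "bounded_clinear f" "bounded_clinear g" "cdense D" "\<And>x. x \<in> D \<Longrightarrow> f x = g x"
  shows "f x = g x"
proof -
  obtain X where X: "\<And>n. X n \<in> D" "cconv X x" using cdense_in_seq[OF assms(3)] by (metis UNIV_I)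
  have "cconv (\<lambda>n. f (X n)) (f x)" "cconv (\<lambda>n. g (X n)) (g x)"
    using assms(1,2) X(2) by (auto intro: bounded_clinear_cconv)
  moreover have "f (X n) = g (X n)" for n using assms(4) X(1) by simp
  ultimately show ?thesis using cconv_unique by fastforce
qed

section \<open>Subspaces and closures\<close>

lemma csubspace_zero: "csubspace S \<Longrightarrow> 0 \<in> S"
  and csubspace_add: "csubspace S \<Longrightarrow> x \<in> S \<Longrightarrow> y \<in> S \<Longrightarrow> x + y \<in> S"
  and csubspace_scaleC: "csubspace S \<Longrightarrow> x \<in> S \<Longrightarrow> c *\<^sub>C x \<in> S"
  by (simp_all add: csubspace_def)

lemma csubspace_minus: "csubspace S \<Longrightarrow> x \<in> S \<Longrightarrow> - x \<in> S"
  using csubspace_scaleC[of S x "-1"] by simp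

lemma csubspace_diff: "csubspace S \<Longrightarrow> x \<in> S \<Longrightarrow> y \<in> S \<Longrightarrow> x - y \<in> S"
  using csubspace_add[of S x "- y"] by (simp add: csubspace_minus)

lemma csubspace_UNIV: "csubspace UNIV"
  by (simp add: csubspace_def)

lemma csubspace_image:
  assumes "bounded_clinear f" "csubspace S" shows "csubspace (f ` S)"
  unfolding csubspace_def
proof (intro conjI ballI allI)
  show "0 \<in> f ` S" by (metis assms bounded_clinear_zero csubspace_zero imageI)
  show "x + y \<in> f ` S" if "x \<in> f ` S" "y \<in> f ` S" for x y
    using that csubspace_add[OF assms(2)] by (auto simp flip: bounded_clinear_add[OF assms(1)])
  show "c *\<^sub>C x \<in> f ` S" if "x \<in> f ` S" for c x
    using that csubspace_scaleC[OF assms(2)] by (auto simp flip: bounded_clinear_scaleC[OF assms(1)])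
qed

lemma cclosedD: "cclosed S \<Longrightarrow> (\<And>n. X n \<in> S) \<Longrightarrow> cconv X L \<Longrightarrow> L \<in> S"
  unfolding cclosed_def by blast

definition cclosure :: "'a::complex_inner set \<Rightarrow> 'a set" where
  "cclosure S = {x. \<exists>X. (\<forall>n. X n \<in> S) \<and> cconv X x}"

lemma cclosureI: "(\<And>n. X n \<in> S) \<Longrightarrow> cconv X x \<Longrightarrow> x \<in> cclosure S"
  unfolding cclosure_def by blast

lemma subset_cclosure: "S \<subseteq> cclosure S"
proof
  show "x \<in> cclosure S" if "x \<in> S" for x
    using cclosureI[of "\<lambda>n. x"] that by simp
qed

lemma cclosure_minimal: "S \<subseteq> J \<Longrightarrow> cclosed J \<Longrightarrow> cclosure S \<subseteq> J"
  unfolding cclosure_def cclosed_def by blast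

lemma cclosure_approx:
  assumes "x \<in> cclosure S" "e > 0" shows "\<exists>y\<in>S. cnorm (x - y) < e"
proof -
  obtain X where X: "\<And>n. X n \<in> S" "cconv X x" using assms(1) unfolding cclosure_def by blast
  then obtain n where "cnorm (X n - x) < e" using LIMSEQ_D[OF X(2) assms(2)] by auto
  then show ?thesis using X(1) by (auto simp: cnorm_minus_commute)
qed

lemma cclosed_cclosure: "cclosed (cclosure S)"
  unfolding cclosed_def
proof (intro allI impI)
  fix X L assume X: "\<forall>n. X n \<in> cclosure S" "cconv X L"
  \<comment> \<open>Density in a single point means only that \<open>L\<close> can be approximated
    from \<open>S\<close>; in this form \<open>cdense_in_seq\<close> picks the approximating
    sequence and no diagonal argument is required.\<close>
  have "cdense_in S {L}"
    unfolding cdense_in_def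
  proof (intro ballI allI impI)
    fix x and e :: real assume x: "x \<in> {L}" "e > 0"
    obtain n where n: "cnorm (X n - L) < e/2" using LIMSEQ_D[OF X(2), of "e/2"] x(2) by auto
    obtain y where "y \<in> S" "cnorm (X n - y) < e/2" using cclosure_approx[of "X n" S "e/2"] X(1) x(2) by auto
    then show "\<exists>y\<in>S. cnorm (x - y) < e"
      using n cnorm_triangle_diff[of L y "X n"] x(1) by (force simp: cnorm_minus_commute)
  qed
  then show "L \<in> cclosure S"
    unfolding cclosure_def using cdense_in_seq[of S "{L}" L] by blast
qed

lemma csubspace_cclosure:
  assumes "csubspace S" shows "csubspace (cclosure S)"
  unfolding csubspace_def
proof (intro conjI ballI allI)
  show "0 \<in> cclosure S" using subset_cclosure csubspace_zero[OF assms] by blast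
  fix x y assume xy: "x \<in> cclosure S" "y \<in> cclosure S"
  then obtain X Y where "\<And>n. X n \<in> S" "cconv X x" "\<And>n. Y n \<in> S" "cconv Y y"
    unfolding cclosure_def by blast
  then show "x + y \<in> cclosure S"
    by (intro cclosureI[where X = "\<lambda>n. X n + Y n"] cconv_add csubspace_add[OF assms])
next
  fix c x assume "x \<in> cclosure S"
  then obtain X where "\<And>n. X n \<in> S" "cconv X x" unfolding cclosure_def by blast
  then show "c *\<^sub>C x \<in> cclosure S"
    by (intro cclosureI[where X = "\<lambda>n. c *\<^sub>C X n"] cconv_scaleC csubspace_scaleC[OF assms])
qed

subsection \<open>Orthogonal projections and adjoints\<close>

text \<open>A minimising sequence for the distance from \<open>x\<close> to \<open>M\<close> is
  Cauchy by the parallelogram law, and its limit is the foot of the perpendicular.\<close>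

lemma projection_exists:
  fixes M :: "'a::chilbert_space set"
  assumes sub: "csubspace M" and cl: "cclosed M"
  shows "\<exists>p\<in>M. x - p \<in> orth_compl M"
proof -
  define d where "d = Inf ((\<lambda>m. (cnorm (x - m))\<^sup>2) ` M)"
  have ne: "(\<lambda>m. (cnorm (x - m))\<^sup>2) ` M \<noteq> {}" using csubspace_zero[OF sub] by blast
  have bdd: "bdd_below ((\<lambda>m. (cnorm (x - m))\<^sup>2) ` M)" by (rule bdd_belowI[of _ 0]) auto
  have dle: "d \<le> (cnorm (x - m))\<^sup>2" if "m \<in> M" for m
    unfolding d_def using that bdd by (simp add: cInf_lower)
  have "\<exists>m\<in>M. (cnorm (x - m))\<^sup>2 < d + inverse (real (Suc n))" for n
    using cInf_less_iff[OF ne bdd, of "d + inverse (real (Suc n))"] by (auto simp: d_def)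
  then obtain X where X: "\<And>n. X n \<in> M" "\<And>n. (cnorm (x - X n))\<^sup>2 < d + inverse (real (Suc n))"
    by metis
  have key: "(cnorm (X m - X n))\<^sup>2 \<le> 2 * inverse (real (Suc m)) + 2 * inverse (real (Suc n))" for m n
  proof -
    \<comment> \<open>The midpoint of \<open>X m\<close> and \<open>X n\<close> stays in
      \<open>M\<close>, so its squared distance from \<open>x\<close> is at least \<open>d\<close>;
      the parallelogram law turns this into an upper bound for the gap between the two.\<close>
    let ?h = "(1/2) *\<^sub>C (X m + X n)"
    have "?h \<in> M" using X(1) sub by (simp add: csubspace_add csubspace_scaleC)
    then have "4 * d \<le> (2 * cnorm (x - ?h))\<^sup>2" using dle by (simp add: power_mult_distrib)
    also have "2 * cnorm (x - ?h) = cnorm (2 *\<^sub>C (x - ?h))" by (simp add: cnorm_scaleC)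
    also have "2 *\<^sub>C (x - ?h) = (x - X m) + (x - X n)"
      using scaleC_add_left[of 1 1 x]
      by (simp add: cvs.scale_right_diff_distrib)
    finally have "4 * d \<le> (cnorm ((x - X m) + (x - X n)))\<^sup>2" .
    moreover have "cnorm ((x - X m) - (x - X n)) = cnorm (X m - X n)"
      by (simp add: cnorm_minus_commute)
    ultimately show ?thesis
      using parallelogram_law[of "x - X m" "x - X n"] X(2)[of m] X(2)[of n] by simp
  qed
  have "ccauchy X"
    unfolding ccauchy_def
  proof (intro allI impI)
    fix e :: real assume e: "e > 0"
    obtain M where M: "inverse (real (Suc M)) < e\<^sup>2 / 4" using e reals_Archimedean[of "e\<^sup>2/4"] by auto
    have "cnorm (X m - X n) < e" if "m \<ge> M" "n \<ge> M" for m n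
    proof -
      have "inverse (real (Suc m)) \<le> inverse (real (Suc M))" "inverse (real (Suc n)) \<le> inverse (real (Suc M))"
        using that by (simp_all add: le_imp_inverse_le)
      then have "(cnorm (X m - X n))\<^sup>2 < e\<^sup>2" using key[of m n] M by linarith
      then show ?thesis using e by (metis less_imp_le power2_less_imp_less)
    qed
    then show "\<exists>M. \<forall>m\<ge>M. \<forall>n\<ge>M. cnorm (X m - X n) < e" by blast
  qed
  then obtain p where p: "cconv X p" by (rule ccauchy_convergent)
  have pM: "p \<in> M" using cl X(1) p unfolding cclosed_def by blast
  have "cconv (\<lambda>n. x - X n) (x - p)" using p by (simp add: cnorm_minus_commute)
  then have "(\<lambda>n. (cnorm (x - X n))\<^sup>2) \<longlonglongrightarrow> (cnorm (x - p))\<^sup>2" by (intro tendsto_power cconv_cnorm)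
  moreover have "(\<lambda>n. d + inverse (real (Suc n))) \<longlonglongrightarrow> d"
    using tendsto_add[OF tendsto_const[of d] LIMSEQ_inverse_real_of_nat] by simp
  ultimately have pd: "(cnorm (x - p))\<^sup>2 \<le> d"
    using X(2) by (intro LIMSEQ_le) (auto intro: less_imp_le)
  \<comment> \<open>Removing from \<open>x - p\<close> its component along \<open>m\<close> amounts
    to moving \<open>p\<close> within \<open>M\<close>, which cannot bring it closer to
    \<open>x\<close>; by Pythagoras the component is zero.\<close>
  have "cinner m (x - p) = 0" if m: "m \<in> M" for m
  proof (cases "m = 0")
    case False
    define c where "c = cinner m (x - p) / cinner m m"
    define w where "w = (x - p) - c *\<^sub>C m"
    have nz: "cinner m m \<noteq> 0" using False by (simp add: cinner_eq_zero_iff)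
    have mw: "cinner m w = 0" using nz by (simp add: w_def c_def cinner_simps)
    have "w = x - (p + c *\<^sub>C m)" by (simp add: w_def algebra_simps)
    then have "d \<le> (cnorm w)\<^sup>2" using dle pM m sub by (simp add: csubspace_add csubspace_scaleC)
    moreover have "x - p = c *\<^sub>C m + w" by (simp add: w_def)
    then have "(cnorm (x - p))\<^sup>2 = (cnorm (c *\<^sub>C m))\<^sup>2 + (cnorm w)\<^sup>2"
      using cnorm_add_sq[of "c *\<^sub>C m" w] mw by (simp add: cinner_simps)
    ultimately have "(cnorm (c *\<^sub>C m))\<^sup>2 \<le> 0" using pd by linarith
    then have "c = 0" using False by simp
    then show ?thesis using nz by (simp add: c_def)
  qed simp
  then show ?thesis using pM unfolding orth_compl_def by blast
qed

definition cproj :: "'a::complex_inner set \<Rightarrow> 'a \<Rightarrow> 'a" where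
  "cproj M x = (SOME p. p \<in> M \<and> x - p \<in> orth_compl M)"

context
  fixes M :: "'a::chilbert_space set"
  assumes sub: "csubspace M" and cl: "cclosed M"
begin

lemma cproj_mem: "cproj M x \<in> M" and cproj_orth: "x - cproj M x \<in> orth_compl M"
  using someI_ex[of "\<lambda>p. p \<in> M \<and> x - p \<in> orth_compl M"] projection_exists[OF sub cl, of x]
  unfolding cproj_def by blast+

lemma cinner_cproj: "m \<in> M \<Longrightarrow> cinner m (cproj M x) = cinner m x"
  using cproj_orth[of x] by (simp add: orth_compl_def cinner_simps)

text \<open>Pins down the chosen point by its inner products with \<open>M\<close>, so that
  linearity of the projection becomes a computation.\<close>

lemma cproj_unique:
  assumes "p \<in> M" "\<And>m. m \<in> M \<Longrightarrow> cinner m p = cinner m x" shows "cproj M x = p"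
proof -
  have "cproj M x - p \<in> M" using cproj_mem assms(1) by (simp add: csubspace_diff sub)
  then have "cinner (cproj M x - p) (cproj M x - p) = 0"
    using assms(2) cinner_cproj by (simp add: cinner_diff_right)
  then show ?thesis by (simp add: cinner_eq_zero_iff)
qed

lemma cproj_ident: "x \<in> M \<Longrightarrow> cproj M x = x"
  by (rule cproj_unique) simp_all

lemma cproj_symmetric: "cinner (cproj M x) y = cinner x (cproj M y)"
  by (metis cproj_mem cinner_conj cinner_cproj)

lemma bounded_clinear_cproj: "bounded_clinear (cproj M)"
proof (rule bounded_clinearI[where K = 1])
  show "cproj M (x + y) = cproj M x + cproj M y" for x y
    by (rule cproj_unique) (simp_all add: csubspace_add sub cproj_mem cinner_simps cinner_cproj)
  show "cproj M (c *\<^sub>C x) = c *\<^sub>C cproj M x" for c x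
    by (rule cproj_unique) (simp_all add: csubspace_scaleC sub cproj_mem cinner_simps cinner_cproj)
  show "cnorm (cproj M x) \<le> 1 * cnorm x" for x
  proof (cases "cproj M x = 0")
    case False
    have "cnorm (cproj M x) * cnorm (cproj M x) \<le> cnorm (cproj M x) * cnorm x"
      using Re_cinner_le[of "cproj M x" x] cnorm_sq[of "cproj M x"] cinner_cproj[OF cproj_mem, of x x]
      by (simp add: power2_eq_square)
    moreover have "cnorm (cproj M x) > 0" using False by (simp add: less_le)
    ultimately show ?thesis by simp
  qed simp
qed

end

text \<open>Split \<open>x\<close> along the closure of \<open>D\<close>: the remainder stays in
  \<open>J\<close> and is orthogonal to \<open>D\<close>, so it vanishes.\<close>

lemma cdense_in_orthogonal:
  fixes J :: "'a::chilbert_space set"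
  assumes "csubspace D" "csubspace J" "cclosed J" "D \<subseteq> J"
    and "\<And>y. y \<in> J \<Longrightarrow> (\<And>x. x \<in> D \<Longrightarrow> cinner x y = 0) \<Longrightarrow> y = 0"
  shows "cdense_in D J"
proof -
  have "x \<in> cclosure D" if x: "x \<in> J" for x
  proof -
    obtain p where p: "p \<in> cclosure D" "x - p \<in> orth_compl (cclosure D)"
      using projection_exists[OF csubspace_cclosure[OF assms(1)] cclosed_cclosure] by blast
    have "p \<in> J" using p(1) cclosure_minimal assms(3,4) by blast
    then have "x - p \<in> J" using x assms(2) by (simp add: csubspace_diff)
    then have "x - p = 0"
      using assms(5) p(2) subset_cclosure[of D] unfolding orth_compl_def by blast
    then show ?thesis using p(1) by simp
  qed
  then show ?thesis unfolding cdense_in_def using cclosure_approx by blast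
qed

lemma cclosed_UNIV: "cclosed UNIV"
  by (simp add: cclosed_def)

lemmas cdense_orthogonal = cdense_in_orthogonal[OF _ csubspace_UNIV cclosed_UNIV subset_UNIV, simplified]

text \<open>The tool for surjectivity throughout: a closed range with trivial orthogonal complement
  is everything.\<close>

lemma closed_subspace_eqI:
  fixes M :: "'a::chilbert_space set"
  assumes "csubspace M" "cclosed M" "csubspace J" "M \<subseteq> J"
    and "\<And>y. y \<in> J \<Longrightarrow> (\<And>x. x \<in> M \<Longrightarrow> cinner x y = 0) \<Longrightarrow> y = 0"
  shows "M = J"
proof -
  have "x \<in> M" if "x \<in> J" for x
  proof -
    obtain p where p: "p \<in> M" "x - p \<in> orth_compl M" using projection_exists[OF assms(1,2)] by blast
    have "x - p \<in> J" using p(1) assms(3,4) that by (auto intro: csubspace_diff)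
    then have "x - p = 0" using p(2) assms(5) unfolding orth_compl_def by blast
    then show ?thesis using p(1) by simp
  qed
  then show ?thesis using assms(4) by blast
qed

lemma Riesz_representation:
  fixes f :: "'a::chilbert_space \<Rightarrow> complex"
  assumes add: "\<And>x y. f (x + y) = f x + f y" and scale: "\<And>c x. f (c *\<^sub>C x) = c * f x"
    and bound: "\<And>x. cmod (f x) \<le> K * cnorm x"
  shows "\<exists>z. \<forall>x. f x = cinner z x"
proof (cases "\<forall>x. f x = 0")
  case True
  then show ?thesis by (intro exI[of _ 0]) simp
next
  case False
  then obtain u where u: "f u \<noteq> 0" by blast
  have zero: "f 0 = 0" using add[of 0 0] by simp
  have diff: "f (x - y) = f x - f y" for x y using add[of "x - y" y] by simp
  define M where "M = {x. f x = 0}"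
  have "csubspace M" by (simp add: M_def csubspace_def zero add scale)
  moreover have "cclosed M"
    unfolding cclosed_def
  proof (intro allI impI)
    fix X L assume X: "\<forall>n. X n \<in> M" "cconv X L"
    have "(\<lambda>n. f (X n) - f L) \<longlonglongrightarrow> 0"
      by (rule tendsto_0_le[OF X(2), where K = K]) (simp add: bound mult.commute flip: diff)
    then show "L \<in> M" using X(1) by (simp add: M_def LIMSEQ_const_iff)
  qed
  ultimately obtain p where p: "p \<in> M" "u - p \<in> orth_compl M" using projection_exists by blast
  \<comment> \<open>The kernel \<open>M\<close> of \<open>f\<close> has codimension one and
    \<open>w\<close> spans its orthogonal complement, so the representing vector is a multiple of
    \<open>w\<close>; applying \<open>f\<close> to \<open>w\<close> fixes the factor.\<close>
  define w where "w = u - p"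
  have fw: "f w \<noteq> 0" using u p(1) by (simp add: w_def diff M_def)
  then have nz: "cinner w w \<noteq> 0" using zero by (auto simp: cinner_eq_zero_iff)
  have "f x = cinner (cnj (f w / cinner w w) *\<^sub>C w) x" for x
  proof -
    have "x - (f x / f w) *\<^sub>C w \<in> M" using fw by (simp add: M_def diff scale)
    then have "cinner (x - (f x / f w) *\<^sub>C w) w = 0" using p(2) by (simp add: w_def orth_compl_def)
    then have "cinner w (x - (f x / f w) *\<^sub>C w) = 0" using cinner_commute_zero by blast
    then have "cinner w x = f x / f w * cinner w w" by (simp add: cinner_simps)
    then show ?thesis using fw nz by (simp add: cinner_scaleC_left)
  qed
  then show ?thesis by blast
qed

text \<open>Riesz representation supplies an adjoint, so the choice in the definition of
  \<open>cadj\<close> picks a genuine one.\<close>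

lemma cadj:
  fixes A :: "'a::chilbert_space \<Rightarrow> 'a"
  assumes "bounded_clinear A"
  shows "cinner (A x) y = cinner x (cadj A y)"
proof -
  obtain K where K: "K > 0" "\<And>x. cnorm (A x) \<le> K * cnorm x" using bounded_clinear_bound[OF assms] by blast
  have "\<exists>z. \<forall>x. cinner y (A x) = cinner z x" for y
  proof (rule Riesz_representation)
    show "cmod (cinner y (A x)) \<le> (cnorm y * K) * cnorm x" for x
      using Cauchy_Schwarz[of y "A x"] mult_left_mono[OF K(2)[of x], of "cnorm y"] by simp
  qed (simp_all add: assms bounded_clinear_simps cinner_simps)
  then obtain B where "\<And>x y. cinner y (A x) = cinner (B y) x" by metis
  then have "\<forall>x y. cinner (A x) y = cinner x (B y)" by (metis cinner_conj)
  then have "\<forall>x y. cinner (A x) y = cinner x (cadj A y)"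
    unfolding cadj_def by (rule someI[where P = "\<lambda>B. \<forall>x y. cinner (A x) y = cinner x (B y)"])
  then show ?thesis by blast
qed

text \<open>The lower bound makes preimages of a convergent sequence Cauchy. This yields closed
  ranges both for isometries and for imaginary shifts of the identity.\<close>

lemma bounded_below_closed_image:
  fixes f :: "'a::chilbert_space \<Rightarrow> 'b::complex_inner"
  assumes f: "bounded_clinear f" and K: "\<And>x. cnorm x \<le> K * cnorm (f x)" and S: "cclosed S"
  shows "cclosed (f ` S)"
  unfolding cclosed_def
proof (intro allI impI)
  fix Y L assume Y: "\<forall>n. Y n \<in> f ` S" "cconv Y L"
  then have "\<forall>n. \<exists>x. x \<in> S \<and> Y n = f x" by auto
  then obtain X where X: "\<And>n. X n \<in> S" "\<And>n. Y n = f (X n)" by metis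
  have "ccauchy X"
  proof (rule ccauchy_mono[OF cconv_imp_ccauchy[OF Y(2)], of "\<bar>K\<bar>"])
    show "cnorm (X m - X n) \<le> \<bar>K\<bar> * cnorm (Y m - Y n)" for m n
      using order_trans[OF K[of "X m - X n"] mult_right_mono[OF abs_ge_self]]
      by (simp add: X(2) bounded_clinear_diff[OF f])
  qed simp
  then obtain x where x: "cconv X x" by (rule ccauchy_convergent)
  have "cconv Y (f x)" using bounded_clinear_cconv[OF f x] X(2) by simp
  then have "L = f x" using Y(2) cconv_unique by blast
  moreover have "x \<in> S" using S X(1) x unfolding cclosed_def by blast
  ultimately show "L \<in> f ` S" by blast
qed

subsection \<open>Dimension\<close>

lemma csubspace_iff_subspace: "csubspace S \<longleftrightarrow> cvs.subspace S"
  by (auto simp: csubspace_def cvs.subspace_def)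

lemma csubspace_orth_compl: "csubspace (orth_compl S)"
  by (auto simp: csubspace_def orth_compl_def cinner_simps)

lemma orthonormal_independent:
  assumes "finite B" "orthonormal B" shows "cvs.independent B"
proof
  assume "cvs.dependent B"
  then obtain u v where uv: "v \<in> B" "u v \<noteq> 0" "(\<Sum>w\<in>B. u w *\<^sub>C w) = 0"
    using cvs.dependent_finite[OF assms(1)] by blast
  have "cinner v (u w *\<^sub>C w) = (if w = v then u w else 0)" if "w \<in> B" for w
    using assms(2) uv(1) that by (auto simp: orthonormal_def cinner_simps)
  then have "cinner v (\<Sum>w\<in>B. u w *\<^sub>C w) = u v"
    using assms(1) uv(1) by (simp add: cinner_sum_right)
  then show False using uv by simp
qed

text \<open>\<open>hdim\<close> counts orthonormal sets only. This lets it be compared along linear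
  maps that preserve independence but not angles.\<close>

lemma Gram_Schmidt:
  assumes "finite B" "cvs.independent B"
  shows "\<exists>C. finite C \<and> card C = card B \<and> orthonormal C \<and> cvs.span C = cvs.span B"
  using assms
proof (induction B rule: finite_induct)
  case empty
  then show ?case by (intro exI[of _ "{}"]) (simp add: orthonormal_def)
next
  case (insert b B)
  then have ind: "cvs.independent B" and b: "b \<notin> cvs.span B"
    by (simp_all add: cvs.independent_insert)
  obtain C where C: "finite C" "card C = card B" "orthonormal C" "cvs.span C = cvs.span B"
    using insert.IH[OF ind] by blast
  define p where "p = (\<Sum>c\<in>C. cinner c b *\<^sub>C c)"
  define w where "w = b - p"
  define e where "e = complex_of_real (1 / cnorm w) *\<^sub>C w"
  have p: "p \<in> cvs.span C"
    unfolding p_def by (intro cvs.span_sum cvs.span_scale cvs.span_base)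
  have "w \<noteq> 0" using p b C(4) by (auto simp: w_def)
  then have nw: "cnorm w \<noteq> 0" by simp
  have cw: "cinner c w = 0" if c: "c \<in> C" for c
  proof -
    have "cinner c (cinner d b *\<^sub>C d) = (if d = c then cinner c b else 0)" if "d \<in> C" for d
      using C(3) c that by (auto simp: orthonormal_def cinner_simps)
    then have "cinner c p = cinner c b" using C(1) c by (simp add: p_def cinner_sum_right)
    then show ?thesis by (simp add: w_def cinner_simps)
  qed
  then have ce: "cinner c e = 0" "cinner e c = 0" if "c \<in> C" for c
    using that cinner_commute_zero by (auto simp: e_def cinner_simps)
  have ee: "cinner e e = 1"
    unfolding e_def cinner_scaleC_left cinner_scaleC_right cinner_self[of w]
    using nw by (simp add: power2_eq_square)
  have eC: "e \<notin> C" using ce ee by force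
  have be: "b = p + complex_of_real (cnorm w) *\<^sub>C e"
    using nw by (simp add: e_def w_def flip: of_real_mult)
  have sC: "cvs.span C \<subseteq> cvs.span (insert b B)" "cvs.span C \<subseteq> cvs.span (insert e C)"
    unfolding C(4) by (simp_all add: C(4)[symmetric] cvs.span_mono subset_insertI)
      (simp add: C(4) cvs.span_mono subset_insertI)
  have "w \<in> cvs.span (insert b B)"
    unfolding w_def using p sC by (intro cvs.span_diff) (auto intro: cvs.span_base)
  then have "insert e C \<subseteq> cvs.span (insert b B)"
    using sC(1) cvs.span_superset[of C] by (auto simp: e_def intro: cvs.span_scale)
  moreover have "b \<in> cvs.span (insert e C)"
    unfolding be using p sC by (intro cvs.span_add cvs.span_scale) (auto intro: cvs.span_base)
  then have "insert b B \<subseteq> cvs.span (insert e C)"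
    using sC(2) cvs.span_superset[of B] C(4) by auto
  ultimately have "cvs.span (insert e C) = cvs.span (insert b B)"
    by (simp add: cvs.span_eq)
  moreover have "orthonormal (insert e C)" using C(3) ce ee by (auto simp: orthonormal_def)
  ultimately show ?case
    using C(1,2) eC insert.hyps by (intro exI[of _ "insert e C"]) simp
qed

text \<open>The image of a finite orthonormal set is linearly independent, and orthonormalising it
  inside its span keeps both its size and its place in \<open>S'\<close>.\<close>

lemma hdim_le_injective_image:
  assumes f: "bounded_clinear f" "inj f" and S: "f ` S \<subseteq> S'" "csubspace S'"
  shows "hdim S \<le> hdim S'"
  unfolding hdim_def[of S]
proof (rule Sup_least)
  fix n assume "n \<in> {enat (card B) |B. finite B \<and> B \<subseteq> S \<and> orthonormal B}"
  then obtain B where B: "n = enat (card B)" "finite B" "B \<subseteq> S" "orthonormal B" by blast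
  have fsum: "f (sum g B) = (\<Sum>b\<in>B. f (g b))" for g
    using B(2) by (induction B rule: finite_induct) (simp_all add: f bounded_clinear_simps)
  have inj: "inj_on f B" using f(2) inj_on_subset by blast
  have "cvs.independent (f ` B)"
  proof
    assume "cvs.dependent (f ` B)"
    then obtain u b where u: "b \<in> B" "u (f b) \<noteq> 0" "(\<Sum>v\<in>f ` B. u v *\<^sub>C v) = 0"
      using cvs.dependent_finite[of "f ` B"] B(2) by blast
    have "f (\<Sum>b\<in>B. u (f b) *\<^sub>C b) = (\<Sum>b\<in>B. u (f b) *\<^sub>C f b)"
      by (simp add: fsum f bounded_clinear_simps)
    also have "\<dots> = f 0" using u(3) by (simp add: sum.reindex[OF inj] f bounded_clinear_simps)
    finally have "(\<Sum>b\<in>B. u (f b) *\<^sub>C b) = 0" using f(2) injD by metis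
    then have "cvs.dependent B"
      unfolding cvs.dependent_finite[OF B(2)] using u(1,2) by (intro exI[of _ "u \<circ> f"]) auto
    then show False using orthonormal_independent[OF B(2,4)] by blast
  qed
  then obtain C where C: "finite C" "card C = card (f ` B)" "orthonormal C" "cvs.span C = cvs.span (f ` B)"
    using Gram_Schmidt[of "f ` B"] B(2) by blast
  have "cvs.span C \<subseteq> S'"
    unfolding C(4) using B(3) S by (intro cvs.span_minimal) (auto simp: csubspace_iff_subspace)
  then have "C \<subseteq> S'" using cvs.span_superset by blast
  moreover have "n = enat (card C)" using B(1) C(2) card_image[OF inj] by simp
  ultimately show "n \<le> hdim S'"
    unfolding hdim_def using C(1,3) by (intro Sup_upper) blast
qed

subsection \<open>Square roots of positive operators\<close>

text \<open>Positivity is applied to the vector \<open>x - (1/K) Q x\<close>; the term cubic in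
  \<open>Q\<close> is absorbed by the norm bound \<open>K\<close>.\<close>

lemma positive_norm_bound:
  assumes Q: "bounded_clinear Q" and sym: "\<And>x y. cinner (Q x) y = cinner x (Q y)"
    and pos: "\<And>x. 0 \<le> Re (cinner x (Q x))"
    and K: "K > 0" "\<And>x. cnorm (Q x) \<le> K * cnorm x"
  shows "(cnorm (Q x))\<^sup>2 \<le> K * Re (cinner x (Q x))"
proof -
  let ?t = "complex_of_real (1 / K)"
  have "Re (cinner (Q x) (Q (Q x))) \<le> cnorm (Q x) * (K * cnorm (Q x))"
    using Re_cinner_le[of "Q x" "Q (Q x)"] mult_left_mono[OF K(2)[of "Q x"] cnorm_ge_zero[of "Q x"]]
    by linarith
  then have le: "Re (cinner (Q x) (Q (Q x))) / K\<^sup>2 \<le> (cnorm (Q x))\<^sup>2 / K"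
    using K(1) by (simp add: field_simps power2_eq_square)
  have "0 \<le> Re (cinner (x - ?t *\<^sub>C Q x) (Q (x - ?t *\<^sub>C Q x)))" by (rule pos)
  also have "\<dots> = Re (cinner x (Q x)) - 2 / K * (cnorm (Q x))\<^sup>2 + Re (cinner (Q x) (Q (Q x))) / K\<^sup>2"
    unfolding bounded_clinear_diff[OF Q] bounded_clinear_scaleC[OF Q] cinner_simps cnorm_sq
      sym[of x "Q x", symmetric]
    by (simp add: diff_divide_distrib power2_eq_square)
  finally have "(cnorm (Q x))\<^sup>2 / K \<le> Re (cinner x (Q x))" using le by simp
  then show ?thesis using K(1) by (simp add: field_simps)
qed

lemma positive_eq_zero:
  assumes Q: "bounded_clinear Q" and sym: "\<And>x y. cinner (Q x) y = cinner x (Q y)"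
    and pos: "\<And>x. 0 \<le> Re (cinner x (Q x))" and "Re (cinner x (Q x)) \<le> 0"
  shows "Q x = 0"
proof -
  obtain K where K: "K > 0" "\<And>x. cnorm (Q x) \<le> K * cnorm x"
    using bounded_clinear_bound[OF Q] by blast
  have "(cnorm (Q x))\<^sup>2 \<le> K * Re (cinner x (Q x))" by (rule positive_norm_bound[OF Q sym pos K])
  also have "\<dots> \<le> 0" using K(1) assms(4) by (simp add: mult_nonneg_nonpos)
  finally show ?thesis by simp
qed

text \<open>For a contraction \<open>C\<close>, the iterates of \<open>Y \<mapsto> (C + Y\<^sup>2) / 2\<close> converge to \<open>1 - sqrt (1 - C)\<close>.
  Their increments are dominated by those of the scalar iteration with \<open>C = 1\<close>.\<close>

primrec sqrt_iter :: "('a::complex_inner \<Rightarrow> 'a) \<Rightarrow> nat \<Rightarrow> 'a \<Rightarrow> 'a" where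
  "sqrt_iter C 0 = (\<lambda>x. 0)"
| "sqrt_iter C (Suc n) = (\<lambda>x. (1/2) *\<^sub>C (C x + sqrt_iter C n (sqrt_iter C n x)))"

primrec sqrt_majorant :: "nat \<Rightarrow> real" where
  "sqrt_majorant 0 = 0"
| "sqrt_majorant (Suc n) = (1 + (sqrt_majorant n)\<^sup>2) / 2"

lemma sqrt_majorant_bounds: "0 \<le> sqrt_majorant n" "sqrt_majorant n \<le> 1"
proof (induction n)
  case (Suc n)
  have "(sqrt_majorant n)\<^sup>2 \<le> 1" using Suc by (simp add: power_le_one)
  then show "0 \<le> sqrt_majorant (Suc n)" "sqrt_majorant (Suc n) \<le> 1" by simp_all
qed simp_all

lemma sqrt_majorant_incseq: "incseq sqrt_majorant"
proof (rule incseq_SucI)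
  show "sqrt_majorant n \<le> sqrt_majorant (Suc n)" for n
    using zero_le_power2[of "1 - sqrt_majorant n"] by (simp add: power2_diff)
qed

lemma sqrt_majorant_Cauchy: "Cauchy sqrt_majorant"
proof -
  obtain l where "sqrt_majorant \<longlonglongrightarrow> l"
    using incseq_convergent[OF sqrt_majorant_incseq] sqrt_majorant_bounds(2) by blast
  then show ?thesis by (rule LIMSEQ_imp_Cauchy)
qed

text \<open>Every iterate is a polynomial in \<open>C\<close> without constant term, so
  \<open>F\<close> commutes with the iterates and, by continuity, with their limit. The commutation
  clause drives both uniqueness of the root and the invariance of subspaces.\<close>

lemma contraction_fixpoint:
  fixes C :: "'a::chilbert_space \<Rightarrow> 'a"
  assumes C: "bounded_clinear C" and sym: "\<And>x y. cinner (C x) y = cinner x (C y)"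
    and contr: "\<And>x. cnorm (C x) \<le> cnorm x"
  obtains Y where "bounded_clinear Y" "\<And>x y. cinner (Y x) y = cinner x (Y y)"
    "\<And>x. cnorm (Y x) \<le> cnorm x" "\<And>x. Y x = (1/2) *\<^sub>C (C x + Y (Y x))"
    "\<And>F x. bounded_clinear F \<Longrightarrow> (\<And>x. F (C x) = C (F x)) \<Longrightarrow> F (Y x) = Y (F x)"
proof -
  let ?Y = "sqrt_iter C" and ?t = sqrt_majorant
  have lin: "bounded_clinear (?Y n)" for n
  proof (induction n)
    case 0
    show ?case by (auto intro: bounded_clinearI[where K = 0])
  next
    case (Suc n)
    then show ?case
      by (auto intro!: bounded_clinear_scale bounded_clinear_plus C bounded_clinear_compose[of "?Y n" "?Y n"])
  qed
  have symn: "cinner (?Y n x) y = cinner x (?Y n y)" for n x y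
    by (induction n arbitrary: x y) (simp_all add: cinner_simps sym)
  have bd: "cnorm (?Y n x) \<le> ?t n * cnorm x" for n x
  proof (induction n arbitrary: x)
    case (Suc n)
    have "cnorm (?Y n (?Y n x)) \<le> ?t n * (?t n * cnorm x)"
      by (rule order_trans[OF Suc]) (simp add: Suc mult_left_mono sqrt_majorant_bounds)
    then have "cnorm (C x + ?Y n (?Y n x)) \<le> cnorm x + ?t n * (?t n * cnorm x)"
      using cnorm_triangle[of "C x" "?Y n (?Y n x)"] contr[of x] by linarith
    then show ?case unfolding sqrt_iter.simps cnorm_scaleC by (simp add: power2_eq_square algebra_simps)
  qed simp
  have bd1: "cnorm (?Y n x) \<le> cnorm x" for n x
    using order_trans[OF bd[of n x] mult_right_mono[OF sqrt_majorant_bounds(2)[of n] cnorm_ge_zero]] by simp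
  have step: "cnorm (?Y (Suc n) x - ?Y n x) \<le> (?t (Suc n) - ?t n) * cnorm x" for n x
  proof (induction n arbitrary: x)
    case 0
    then show ?case using contr[of x] by (simp add: cnorm_scaleC bounded_clinear_zero[OF C])
  next
    case (Suc n)
    \<comment> \<open>The difference of the squares of consecutive iterates is split as
      \<open>U (U - W) + (U - W) W\<close> with \<open>U\<close> the later and \<open>W\<close> the
      earlier one, so the two factors need not be interchanged.\<close>
    let ?a = "?Y (Suc n) (?Y (Suc n) x - ?Y n x)" and ?b = "?Y (Suc n) (?Y n x) - ?Y n (?Y n x)"
    have "?Y (Suc (Suc n)) x - ?Y (Suc n) x = (1/2) *\<^sub>C (?a + ?b)"
      unfolding bounded_clinear_diff[OF lin] sqrt_iter.simps(2)[of C "Suc n"] sqrt_iter.simps(2)[of C n, THEN fun_cong, of x]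
      by (simp add: cvs.scale_right_diff_distrib scaleC_add_right)
    then have "cnorm (?Y (Suc (Suc n)) x - ?Y (Suc n) x) = cnorm (?a + ?b) / 2"
      by (simp add: cnorm_scaleC)
    also have "\<dots> \<le> (cnorm ?a + cnorm ?b) / 2" by (simp add: cnorm_triangle)
    also have "\<dots> \<le> (?t (Suc n) * ((?t (Suc n) - ?t n) * cnorm x) + (?t (Suc n) - ?t n) * (?t n * cnorm x)) / 2"
    proof -
      have d: "0 \<le> ?t (Suc n) - ?t n" using incseq_SucD[OF sqrt_majorant_incseq, of n] by simp
      have "cnorm ?a \<le> ?t (Suc n) * ((?t (Suc n) - ?t n) * cnorm x)"
        by (rule order_trans[OF bd]) (intro mult_left_mono Suc sqrt_majorant_bounds)
      moreover have "cnorm ?b \<le> (?t (Suc n) - ?t n) * (?t n * cnorm x)"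
        by (rule order_trans[OF Suc]) (intro mult_left_mono bd d)
      ultimately show ?thesis by simp
    qed
    \<comment> \<open>The scalars satisfy the same factorisation, so the bound collapses to the next
      increment of the majorant.\<close>
    also have "\<dots> = ((?t (Suc n))\<^sup>2 - (?t n)\<^sup>2) / 2 * cnorm x"
      by (simp only: power2_eq_square) algebra
    also have "((?t (Suc n))\<^sup>2 - (?t n)\<^sup>2) / 2 = ?t (Suc (Suc n)) - ?t (Suc n)"
      by (simp only: sqrt_majorant.simps(2)[of "Suc n"] sqrt_majorant.simps(2)[of n]) (simp add: field_simps)
    finally show ?case .
  qed
  have inc: "cnorm (?Y (n + k) x - ?Y n x) \<le> (?t (n + k) - ?t n) * cnorm x" for n k x
  proof (induction k)
    case (Suc k)
    have "cnorm (?Y (Suc (n + k)) x - ?Y n x)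
        \<le> (?t (Suc (n + k)) - ?t (n + k)) * cnorm x + (?t (n + k) - ?t n) * cnorm x"
      by (rule order_trans[OF cnorm_triangle_diff[of _ _ "?Y (n + k) x"]]) (intro add_mono step Suc)
    then show ?case unfolding add_Suc_right left_diff_distrib by linarith
  qed simp
  have "ccauchy (\<lambda>n. ?Y n x)" for x
    unfolding ccauchy_def
  proof (intro allI impI)
    fix e :: real assume "e > 0"
    \<comment> \<open>Adding 1 keeps the denominator positive when \<open>x = 0\<close>.\<close>
    then have "e / (cnorm x + 1) > 0" by (simp add: add_nonneg_pos)
    then obtain M where M: "\<And>m n. m \<ge> M \<Longrightarrow> n \<ge> M \<Longrightarrow> \<bar>?t m - ?t n\<bar> < e / (cnorm x + 1)"
      using sqrt_majorant_Cauchy unfolding Cauchy_def dist_real_def by blast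
    have lt: "cnorm (?Y n x - ?Y m x) < e" if "M \<le> m" "m \<le> n" for m n
    proof -
      have "cnorm (?Y n x - ?Y m x) \<le> (?t n - ?t m) * cnorm x" using inc[of m "n - m" x] that by simp
      also have "\<dots> \<le> \<bar>?t n - ?t m\<bar> * (cnorm x + 1)"
        by (intro mult_mono) simp_all
      also have "\<dots> < e / (cnorm x + 1) * (cnorm x + 1)"
        using M[of n m] that by (intro mult_strict_right_mono) (simp_all add: add_nonneg_pos)
      also have "\<dots> = e" using cnorm_ge_zero[of x] by (simp add: field_simps add_nonneg_eq_0_iff)
      finally show ?thesis .
    qed
    have "cnorm (?Y m x - ?Y n x) < e" if "m \<ge> M" "n \<ge> M" for m n
      using lt[of m n] lt[of n m] that by (cases "m \<le> n") (simp_all add: cnorm_minus_commute)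
    then show "\<exists>M. \<forall>m\<ge>M. \<forall>n\<ge>M. cnorm (?Y m x - ?Y n x) < e" by blast
  qed
  then have "\<exists>L. cconv (\<lambda>n. ?Y n x) L" for x using ccauchy_convergent by blast
  then obtain Y where Y: "\<And>x. cconv (\<lambda>n. ?Y n x) (Y x)" by metis
  show thesis
  proof (rule that)
    show contrY: "cnorm (Y x) \<le> cnorm x" for x
      using LIMSEQ_le_const2[OF cconv_cnorm[OF Y[of x]]] bd1 by blast
    show "bounded_clinear Y"
    proof (rule bounded_clinearI[where K = 1])
      show "Y (x + y) = Y x + Y y" for x y
        using cconv_unique[OF Y[of "x + y"]] cconv_add[OF Y[of x] Y[of y]]
        by (simp add: bounded_clinear_add[OF lin])
      show "Y (c *\<^sub>C x) = c *\<^sub>C Y x" for c x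
        using cconv_unique[OF Y[of "c *\<^sub>C x"]] cconv_scaleC[OF Y[of x], of c]
        by (simp add: bounded_clinear_scaleC[OF lin])
    qed (simp add: contrY)
    show "cinner (Y x) y = cinner x (Y y)" for x y
      using LIMSEQ_unique[OF cconv_cinner_left[OF Y[of x], of y]] cconv_cinner_right[OF Y[of y], of x]
      by (simp add: symn)
    show "Y x = (1/2) *\<^sub>C (C x + Y (Y x))" for x
    proof (rule cconv_unique)
      show "cconv (\<lambda>n. ?Y (Suc n) x) (Y x)" using LIMSEQ_Suc[OF Y[of x]] .
      \<comment> \<open>Pointwise convergence passes to the square because the iterates are
        uniformly contractions.\<close>
      have "cconv (\<lambda>n. ?Y n (?Y n x)) (Y (Y x))"
      proof (rule cconv_dominated)
        show "(\<lambda>n. cnorm (?Y n x - Y x) + cnorm (?Y n (Y x) - Y (Y x))) \<longlonglongrightarrow> 0"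
          using tendsto_add[OF Y[of x] Y[of "Y x"]] by simp
        show "cnorm (?Y n (?Y n x) - Y (Y x)) \<le> cnorm (?Y n x - Y x) + cnorm (?Y n (Y x) - Y (Y x))" for n
          using cnorm_triangle_diff[of "?Y n (?Y n x)" "Y (Y x)" "?Y n (Y x)"] bd1[of n "?Y n x - Y x"]
          unfolding bounded_clinear_diff[OF lin] by linarith
      qed
      then show "cconv (\<lambda>n. ?Y (Suc n) x) ((1/2) *\<^sub>C (C x + Y (Y x)))"
        unfolding sqrt_iter.simps by (intro cconv_scaleC cconv_add cconv_const)
    qed
    show "F (Y x) = Y (F x)" if F: "bounded_clinear F" "\<And>x. F (C x) = C (F x)" for F x
    proof (rule cconv_unique)
      have "F (?Y n x) = ?Y n (F x)" for n x
        by (induction n arbitrary: x) (simp_all add: bounded_clinear_simps F)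
      then show "cconv (\<lambda>n. ?Y n (F x)) (F (Y x))" using bounded_clinear_cconv[OF F(1) Y[of x]] by simp
      show "cconv (\<lambda>n. ?Y n (F x)) (Y (F x))" by (rule Y)
    qed
  qed
qed

text \<open>Scaling by a bound \<open>K\<close> makes \<open>C = 1 - B/K\<close> a contraction. The
  fixed point satisfies \<open>2 Y = C + Y Y\<close>, that is, \<open>1 - Y\<close> squares to
  \<open>1 - C = B/K\<close>, so \<open>sqrt K\<close> times \<open>1 - Y\<close> is the root; it is
  positive because \<open>Y\<close> is a contraction.\<close>

lemma positive_sqrt_exists:
  fixes B :: "'a::chilbert_space \<Rightarrow> 'a"
  assumes B: "bounded_clinear B" and sym: "\<And>x y. cinner (B x) y = cinner x (B y)"
    and pos: "\<And>x. 0 \<le> Re (cinner x (B x))"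
  obtains S where "bounded_clinear S" "\<And>x y. cinner (S x) y = cinner x (S y)"
    "\<And>x. 0 \<le> Re (cinner x (S x))" "\<And>x. S (S x) = B x"
    "\<And>F x. bounded_clinear F \<Longrightarrow> (\<And>x. F (B x) = B (F x)) \<Longrightarrow> F (S x) = S (F x)"
proof -
  obtain K where K: "K > 0" "\<And>x. cnorm (B x) \<le> K * cnorm x"
    using bounded_clinear_bound[OF B] by blast
  define C where "C x = x - complex_of_real (1/K) *\<^sub>C B x" for x
  have C: "bounded_clinear C"
    unfolding C_def by (intro bounded_clinear_sub bounded_clinear_ident bounded_clinear_scale B)
  have symC: "cinner (C x) y = cinner x (C y)" for x y
    by (simp add: C_def cinner_simps sym)
  have contr: "cnorm (C x) \<le> cnorm x" for x
  proof (rule power2_le_imp_le)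
    have "(cnorm (C x))\<^sup>2 = (cnorm x)\<^sup>2 - 2 / K * Re (cinner x (B x)) + (cnorm (B x))\<^sup>2 / K\<^sup>2"
      using K(1) by (simp add: C_def cnorm_diff_sq cinner_simps cnorm_scaleC norm_divide power_divide)
    moreover have "(cnorm (B x))\<^sup>2 / K\<^sup>2 \<le> 1 / K * Re (cinner x (B x))"
      using positive_norm_bound[OF B sym pos K, of x] K(1) by (simp add: field_simps power2_eq_square)
    moreover have "0 \<le> 1 / K * Re (cinner x (B x))" using K(1) pos by simp
    ultimately show "(cnorm (C x))\<^sup>2 \<le> (cnorm x)\<^sup>2" by simp
  qed simp
  show thesis
  proof (rule contraction_fixpoint[OF C symC contr])
    fix Y
    assume Y: "bounded_clinear Y" "\<And>x y. cinner (Y x) y = cinner x (Y y)"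
      "\<And>x. cnorm (Y x) \<le> cnorm x" "\<And>x. Y x = (1/2) *\<^sub>C (C x + Y (Y x))"
      "\<And>F x. bounded_clinear F \<Longrightarrow> (\<And>x. F (C x) = C (F x)) \<Longrightarrow> F (Y x) = Y (F x)"
    define S where "S x = complex_of_real (sqrt K) *\<^sub>C (x - Y x)" for x
    show thesis
    proof (rule that)
      show "bounded_clinear S"
        unfolding S_def by (intro bounded_clinear_sub bounded_clinear_ident bounded_clinear_scale Y)
      show "cinner (S x) y = cinner x (S y)" for x y by (simp add: S_def cinner_simps Y(2))
      show "0 \<le> Re (cinner x (S x))" for x
      proof -
        have "Re (cinner x (Y x)) \<le> (cnorm x)\<^sup>2"
          using Re_cinner_le[of x "Y x"] mult_left_mono[OF Y(3)[of x], of "cnorm x"]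
          by (simp add: power2_eq_square)
        then show ?thesis using K(1) by (simp add: S_def cinner_simps cnorm_sq)
      qed
      show "S (S x) = B x" for x
      proof -
        have "2 *\<^sub>C Y x = C x + Y (Y x)" using arg_cong[OF Y(4)[of x], of "scaleC 2"] by simp
        then have "Y x + Y x = C x + Y (Y x)" using scaleC_add_left[of 1 1 "Y x"] by simp
        then have "x - Y x - Y (x - Y x) = x - C x"
          by (simp add: bounded_clinear_simps[OF Y(1)] algebra_simps)
        then have "complex_of_real K *\<^sub>C (x - Y x - Y (x - Y x)) = B x"
          using K(1) by (simp add: C_def flip: of_real_mult)
        moreover have "S (S x) = complex_of_real (sqrt K * sqrt K) *\<^sub>C (x - Y x - Y (x - Y x))"
          unfolding of_real_mult
          by (simp add: S_def bounded_clinear_simps[OF Y(1)] cvs.scale_right_diff_distrib)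
        ultimately show ?thesis using K(1) by simp
      qed
      show "F (S x) = S (F x)" if F: "bounded_clinear F" "\<And>x. F (B x) = B (F x)" for F x
      proof -
        have "F (C x) = C (F x)" for x by (simp add: C_def bounded_clinear_simps F)
        then show ?thesis using Y(5)[OF F(1)] by (simp add: S_def bounded_clinear_simps F)
      qed
    qed
  qed
qed

text \<open>As \<open>Q\<close> and \<open>S\<close> commute and have equal squares,
  \<open>Q + S\<close> kills \<open>y = Q x - S x\<close>. Both positive forms then vanish at
  \<open>y\<close>, so \<open>Q y = S y = 0\<close>, and self-adjointness gives
  \<open>y = 0\<close>.\<close>

lemma positive_sqrt_unique:
  fixes Q S :: "'a::chilbert_space \<Rightarrow> 'a"
  assumes Q: "bounded_clinear Q" "\<And>x y. cinner (Q x) y = cinner x (Q y)" "\<And>x. 0 \<le> Re (cinner x (Q x))"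
    and S: "bounded_clinear S" "\<And>x y. cinner (S x) y = cinner x (S y)" "\<And>x. 0 \<le> Re (cinner x (S x))"
    and sq: "\<And>x. S (S x) = Q (Q x)" and comm: "\<And>x. Q (S x) = S (Q x)"
  shows "S x = Q x"
proof -
  define y where "y = Q x - S x"
  have "Q y + S y = 0" by (simp add: y_def bounded_clinear_simps Q S comm sq)
  then have "Re (cinner y (Q y)) + Re (cinner y (S y)) = 0"
    by (metis cinner_add_right cinner_zero_right plus_complex.sel(1) zero_complex.sel(1))
  then have "Re (cinner y (Q y)) \<le> 0" "Re (cinner y (S y)) \<le> 0"
    using Q(3)[of y] S(3)[of y] by linarith+
  then have "Q y = 0" "S y = 0"
    using positive_eq_zero[OF Q] positive_eq_zero[OF S] by blast+
  moreover have "cinner y y = cinner x (Q y - S y)"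
    unfolding cinner_diff_right Q(2)[symmetric] S(2)[symmetric] by (simp add: y_def cinner_diff_left)
  ultimately have "cinner y y = 0" by simp
  then show ?thesis by (simp add: cinner_eq_zero_iff y_def)
qed

text \<open>The square of \<open>Q\<close> is self-adjoint and leaves \<open>J\<close> invariant,
  hence commutes with the projection onto \<open>J\<close>. Its positive square root inherits the
  commutation, and by uniqueness that root is \<open>Q\<close>.\<close>

lemma positive_invariant_subspace:
  fixes Q :: "'a::chilbert_space \<Rightarrow> 'a"
  assumes Q: "bounded_clinear Q" "\<And>x y. cinner (Q x) y = cinner x (Q y)" "\<And>x. 0 \<le> Re (cinner x (Q x))"
    and J: "csubspace J" "cclosed J" and inv: "\<And>x. x \<in> J \<Longrightarrow> Q (Q x) \<in> J" and x: "x \<in> J"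
  shows "Q x \<in> J"
proof -
  let ?P = "cproj J"
  note P = bounded_clinear_cproj[OF J] cproj_mem[OF J] cproj_ident[OF J] cproj_symmetric[OF J]
  have Q2: "bounded_clinear (\<lambda>x. Q (Q x))" by (rule bounded_clinear_compose[OF Q(1) Q(1)])
  have PQ: "?P (Q (Q x)) = Q (Q (?P x))" for x
  proof (rule cinner_ext)
    fix z
    have "cinner z (?P (Q (Q x))) = cinner (Q (Q (?P z))) x" by (simp add: P(4)[symmetric] Q(2))
    also have "Q (Q (?P z)) = ?P (Q (Q (?P z)))" using P inv by simp
    also have "cinner \<dots> x = cinner z (?P (Q (Q (?P x))))" by (simp add: P(4) Q(2))
    also have "?P (Q (Q (?P x))) = Q (Q (?P x))" using P inv by simp
    finally show "cinner z (?P (Q (Q x))) = cinner z (Q (Q (?P x)))" .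
  qed
  show ?thesis
  proof (rule positive_sqrt_exists[OF Q2])
    show "cinner (Q (Q x)) y = cinner x (Q (Q y))" for x y by (simp add: Q(2))
    show "0 \<le> Re (cinner x (Q (Q x)))" for x
      using cinner_ge_zero[of "Q x"] by (simp add: Q(2))
    fix S
    assume S: "bounded_clinear S" "\<And>x y. cinner (S x) y = cinner x (S y)"
      "\<And>x. 0 \<le> Re (cinner x (S x))" "\<And>x. S (S x) = Q (Q x)"
      "\<And>F x. bounded_clinear F \<Longrightarrow> (\<And>x. F (Q (Q x)) = Q (Q (F x))) \<Longrightarrow> F (S x) = S (F x)"
    have "?P (S x) = S (?P x)" by (rule S(5)[OF P(1) PQ])
    moreover have "S y = Q y" for y
      by (rule positive_sqrt_unique[OF Q S(1-4)]) (rule S(5)[OF Q(1) refl])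
    ultimately have "?P (Q x) = Q x" using P(3)[OF x] by simp
    then show ?thesis by (metis P(2))
  qed
qed

subsection \<open>Isometries\<close>

lemma isometric_extension:
  fixes F G :: "'a::chilbert_space \<Rightarrow> 'a"
  assumes F: "bounded_clinear F" and G: "bounded_clinear G"
    and norm: "\<And>x. cnorm (F x) = cnorm (G x)" and dense: "cdense (range F)"
  obtains V where "is_isometry V" "\<And>x. V (F x) = G x"
proof -
  \<comment> \<open>\<open>R\<close> is the set of limits of pairs \<open>(F x, G x)\<close>. It is
    linear and norm-preserving, hence single-valued, and completeness together with density of the
    range of \<open>F\<close> makes it total; \<open>V\<close> is the map with graph
    \<open>R\<close>.\<close>
  define R where "R y v \<longleftrightarrow> (\<exists>X. cconv (\<lambda>n. F (X n)) y \<and> cconv (\<lambda>n. G (X n)) v)" for y v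
  have RI: "R y v" if "cconv (\<lambda>n. F (X n)) y" "cconv (\<lambda>n. G (X n)) v" for X y v
    using that unfolding R_def by blast
  have add: "R (y + y') (v + v')" if R: "R y v" "R y' v'" for y y' v v'
  proof -
    obtain X where "cconv (\<lambda>n. F (X n)) y \<and> cconv (\<lambda>n. G (X n)) v"
      using R(1) unfolding R_def ..
    moreover obtain X' where "cconv (\<lambda>n. F (X' n)) y' \<and> cconv (\<lambda>n. G (X' n)) v'"
      using R(2) unfolding R_def ..
    ultimately show ?thesis
      by (intro RI[of "\<lambda>n. X n + X' n"]) (simp_all add: bounded_clinear_add F G cconv_add)
  qed
  have scale: "R (c *\<^sub>C y) (c *\<^sub>C v)" if R: "R y v" for c y v
  proof -
    obtain X where "cconv (\<lambda>n. F (X n)) y \<and> cconv (\<lambda>n. G (X n)) v"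
      using R unfolding R_def ..
    then show ?thesis
      by (intro RI[of "\<lambda>n. c *\<^sub>C X n"]) (simp_all add: bounded_clinear_scaleC F G cconv_scaleC)
  qed
  have norm_R: "cnorm v = cnorm y" if R: "R y v" for y v
  proof -
    obtain X where X: "cconv (\<lambda>n. F (X n)) y \<and> cconv (\<lambda>n. G (X n)) v"
      using R unfolding R_def ..
    show ?thesis
      using LIMSEQ_unique[OF cconv_cnorm[OF X[THEN conjunct1]]] cconv_cnorm[OF X[THEN conjunct2]] norm by simp
  qed
  have uniq: "v = v'" if "R y v" "R y v'" for y v v'
    using norm_R[OF add[OF that(1) scale[OF that(2), of "-1"]]] by simp
  have "\<exists>v. R y v" for y
  proof -
    obtain Z where Z: "\<And>n. Z n \<in> range F" "cconv Z y" using cdense_in_seq[OF dense] by blast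
    then have "\<forall>n. \<exists>x. Z n = F x" by blast
    then obtain X where X: "\<And>n. Z n = F (X n)" by metis
    have "ccauchy (\<lambda>n. G (X n))"
    proof (rule ccauchy_mono[OF cconv_imp_ccauchy[OF Z(2)], of 1])
      show "cnorm (G (X m) - G (X n)) \<le> 1 * cnorm (Z m - Z n)" for m n
        by (simp add: X norm flip: bounded_clinear_diff[OF F] bounded_clinear_diff[OF G])
    qed simp
    then obtain v where "cconv (\<lambda>n. G (X n)) v" by (rule ccauchy_convergent)
    then show ?thesis using RI[of X y v] Z(2) X by auto
  qed
  then obtain V where V: "\<And>y. R y (V y)" by metis
  have "is_isometry V"
    unfolding is_isometry_def
  proof (intro conjI allI)
    show n: "cnorm (V x) = cnorm x" for x by (rule norm_R[OF V])
    show "bounded_clinear V"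
      by (rule bounded_clinearI[where K = 1]) (auto simp: n intro: uniq[OF V] add scale V)
  qed
  moreover have "V (F x) = G x" for x
    by (rule uniq[OF V]) (rule RI[of "\<lambda>n. x"], simp_all)
  ultimately show thesis using that by blast
qed

lemma isometry_bounded_clinear: "is_isometry V \<Longrightarrow> bounded_clinear V"
  and isometry_cnorm: "is_isometry V \<Longrightarrow> cnorm (V x) = cnorm x"
  by (simp_all add: is_isometry_def)

lemma cinner_polarization:
  "Re (cinner x y) = ((cnorm (x + y))\<^sup>2 - (cnorm (x - y))\<^sup>2) / 4"
  by (simp add: cnorm_add_sq cnorm_diff_sq)

lemma isometry_cinner:
  assumes "is_isometry V" shows "cinner (V x) (V y) = cinner x y"
proof -
  note V = isometry_bounded_clinear[OF assms]
  have Re: "Re (cinner (V x) (V y)) = Re (cinner x y)" for x y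
    unfolding cinner_polarization
    by (simp add: isometry_cnorm[OF assms] flip: bounded_clinear_add[OF V] bounded_clinear_diff[OF V])
  show ?thesis
    using Re[of x y] Re[of x "\<i> *\<^sub>C y"]
    by (simp add: complex_eq_iff bounded_clinear_scaleC[OF V] cinner_simps)
qed

lemma isometry_inj: "is_isometry V \<Longrightarrow> inj V"
  by (rule bounded_clinear_injI[OF isometry_bounded_clinear]) (metis cnorm_eq_zero isometry_cnorm)+

lemma isometry_closed_range:
  fixes V :: "'a::chilbert_space \<Rightarrow> 'a"
  assumes "is_isometry V" shows "cclosed (range V)"
  using bounded_below_closed_image[OF isometry_bounded_clinear[OF assms] _ cclosed_UNIV, of 1]
  by (simp add: isometry_cnorm[OF assms])

subsection \<open>Inverses of injective self-adjoint operators\<close>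

text \<open>Trades the chosen adjoint for a sesquilinear identity, the form in which the Hankel
  property is used below.\<close>

lemma hankel_iff:
  fixes V :: "'a::chilbert_space \<Rightarrow> 'a"
  assumes "bounded_clinear V"
  shows "hankel V A \<longleftrightarrow> (\<forall>x y. cinner (V x) (A y) = cinner x (A (V y)))"
proof
  assume "hankel V A"
  then have "cadj V (A y) = A (V y)" for y by (simp add: hankel_def fun_eq_iff)
  then show "\<forall>x y. cinner (V x) (A y) = cinner x (A (V y))" by (simp add: cadj[OF assms])
next
  assume *: "\<forall>x y. cinner (V x) (A y) = cinner x (A (V y))"
  have "cadj V (A y) = A (V y)" for y
    by (rule cinner_ext) (simp add: * flip: cadj[OF assms])
  then show "hankel V A" by (simp add: hankel_def fun_eq_iff)
qed

text \<open>A self-adjoint operator is closed, so with the lower bound its range is closed. A vector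
  of \<open>J\<close> orthogonal to the range lies in the kernel of the adjoint, which is
  \<open>T\<close> itself, and the bound makes it zero.\<close>

lemma selfadjoint_bounded_below_onto:
  fixes J :: "'a::chilbert_space set"
  assumes sa: "op_selfadjoint_in J E T" and J: "csubspace J" "cclosed J"
    and bound: "\<And>x. x \<in> E \<Longrightarrow> cnorm x \<le> K * cnorm (T x)"
  shows "T ` E = J"
proof (rule closed_subspace_eqI)
  have E: "csubspace E" "E \<subseteq> J" "T ` E \<subseteq> J" and dense: "cdense_in E J"
    and add: "\<And>x y. x \<in> E \<Longrightarrow> y \<in> E \<Longrightarrow> T (x + y) = T x + T y"
    and scale: "\<And>c x. x \<in> E \<Longrightarrow> T (c *\<^sub>C x) = c *\<^sub>C T x"
    and sym: "\<And>x y. x \<in> E \<Longrightarrow> y \<in> E \<Longrightarrow> cinner (T x) y = cinner x (T y)"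
    and adj: "\<And>y z. y \<in> J \<Longrightarrow> z \<in> J \<Longrightarrow> (\<And>x. x \<in> E \<Longrightarrow> cinner (T x) y = cinner x z) \<Longrightarrow> y \<in> E"
    using sa unfolding op_selfadjoint_in_def op_symmetric_def by blast+
  have diff: "T (x - y) = T x - T y" if "x \<in> E" "y \<in> E" for x y
    using add[of x "(-1) *\<^sub>C y"] scale[of y "-1"] csubspace_scaleC[OF E(1), of y "-1"] that by simp
  \<comment> \<open>The last clause of \<open>op_selfadjoint_in\<close> only places \<open>y\<close>
    in the domain; density of \<open>E\<close> in \<open>J\<close> then also determines the value
    \<open>T y\<close>.\<close>
  have adj': "y \<in> E \<and> T y = z"
    if yz: "y \<in> J" "z \<in> J" "\<And>x. x \<in> E \<Longrightarrow> cinner (T x) y = cinner x z" for y z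
  proof
    show y: "y \<in> E" using adj yz by blast
    show "T y = z"
      using cdense_cinner_eq[OF dense _ yz(2) J(1), of "T y"] y E(3) sym yz(3) by auto
  qed
  show "csubspace (T ` E)"
    unfolding csubspace_def
  proof (intro conjI ballI allI)
    have "T (0 *\<^sub>C 0) = 0 *\<^sub>C T 0" by (rule scale[OF csubspace_zero[OF E(1)]])
    then have "T 0 = 0" by simp
    then show "0 \<in> T ` E" using csubspace_zero[OF E(1)] by (metis imageI)
    show "x + y \<in> T ` E" if "x \<in> T ` E" "y \<in> T ` E" for x y
      using that csubspace_add[OF E(1)] by (auto simp flip: add)
    show "c *\<^sub>C x \<in> T ` E" if "x \<in> T ` E" for c x
      using that csubspace_scaleC[OF E(1)] by (auto simp flip: scale)
  qed
  show "cclosed (T ` E)"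
    unfolding cclosed_def
  proof (intro allI impI)
    fix Y y assume Y: "\<forall>n. Y n \<in> T ` E" "cconv Y y"
    then have "\<forall>n. \<exists>x. x \<in> E \<and> Y n = T x" by auto
    then obtain X where X: "\<And>n. X n \<in> E" "\<And>n. Y n = T (X n)" by metis
    have "ccauchy X"
    proof (rule ccauchy_mono[OF cconv_imp_ccauchy[OF Y(2)], of "\<bar>K\<bar>"])
      show "cnorm (X m - X n) \<le> \<bar>K\<bar> * cnorm (Y m - Y n)" for m n
        using order_trans[OF bound[of "X m - X n"] mult_right_mono[OF abs_ge_self]]
        by (simp add: X diff csubspace_diff E)
    qed simp
    then obtain x where x: "cconv X x" by (rule ccauchy_convergent)
    have "x \<in> J" "y \<in> J"
      using J(2) X E x Y unfolding cclosed_def by blast+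
    moreover have "cinner (T w) x = cinner w y" if w: "w \<in> E" for w
    proof (rule LIMSEQ_unique)
      show "(\<lambda>n. cinner (T w) (X n)) \<longlonglongrightarrow> cinner (T w) x" by (rule cconv_cinner_right[OF x])
      show "(\<lambda>n. cinner (T w) (X n)) \<longlonglongrightarrow> cinner w y"
        using cconv_cinner_right[OF Y(2), of w] sym[OF w X(1)] X(2) by simp
    qed
    ultimately show "y \<in> T ` E" using adj' by blast
  qed
  show "y = 0" if "y \<in> J" "\<And>x. x \<in> T ` E \<Longrightarrow> cinner x y = 0" for y
  proof -
    have "y \<in> E \<and> T y = 0" using that by (intro adj') (auto simp: csubspace_zero J)
    then show ?thesis using bound[of y] by (metis antisym cnorm_eq_zero cnorm_ge_zero cnorm_zero mult_zero_right)
  qed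
  show "T ` E \<subseteq> J" by (rule E(3))
qed (rule J(1))

text \<open>Abstract in the operator because it is instantiated twice: with the given
  \<open>A\<close>, and with the square root \<open>S\<close> that inverts the positive factor of a
  polar decomposition.\<close>

locale injective_selfadjoint =
  fixes A :: "'a::chilbert_space \<Rightarrow> 'a"
  assumes bounded: "bounded_clinear A" and sym: "cinner (A x) y = cinner x (A y)" and inj: "inj A"
begin

lemma eq_zero: "A x = 0 \<Longrightarrow> x = 0"
  using inj bounded_clinear_zero[OF bounded] by (metis injD)

lemma cinner_real: "cinner x (A x) \<in> \<real>"
  by (metis Reals_cnj_iff cinner_conj sym)

text \<open>For purely imaginary \<open>a\<close> the cross term in the squared norm has real part
  zero.\<close>

lemma norm_le_imaginary_shift:
  assumes "cnj a = - a" shows "cnorm x \<le> cnorm (x + a *\<^sub>C A x)"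
proof (rule power2_le_imp_le)
  have "Re a = 0" using arg_cong[OF assms, of Re] by simp
  moreover have "Im (cinner x (A x)) = 0" using cinner_real complex_is_Real_iff by blast
  ultimately have "Re (cinner x (a *\<^sub>C A x)) = 0" by (simp add: cinner_simps)
  then show "(cnorm x)\<^sup>2 \<le> (cnorm (x + a *\<^sub>C A x))\<^sup>2" by (simp add: cnorm_add_sq)
qed simp

text \<open>The norm estimate gives injectivity and closed range. A vector orthogonal to the range
  is killed by the shift with \<open>- a\<close>, to which the same estimate applies.\<close>

lemma imaginary_shift_bij:
  assumes "cnj a = - a" shows "bij (\<lambda>x. x + a *\<^sub>C A x)" (is "bij ?M")
proof (rule bijI)
  have M: "bounded_clinear ?M"
    by (intro bounded_clinear_plus bounded_clinear_ident bounded_clinear_scale bounded)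
  have 0: "x = 0" if "x + a *\<^sub>C A x = 0" for x
    using norm_le_imaginary_shift[OF assms, of x] that
    by (metis antisym cnorm_eq_zero cnorm_ge_zero cnorm_zero)
  show "inj ?M" using bounded_clinear_injI[OF M] 0 by blast
  show "surj ?M"
  proof (rule closed_subspace_eqI)
    show "csubspace (range ?M)" by (rule csubspace_image[OF M csubspace_UNIV])
    show "cclosed (range ?M)"
      by (rule bounded_below_closed_image[OF M _ cclosed_UNIV, of 1])
        (simp add: norm_le_imaginary_shift[OF assms])
    fix y assume "\<And>x. x \<in> range ?M \<Longrightarrow> cinner x y = 0"
    then have y: "cinner (x + a *\<^sub>C A x) y = 0" for x by blast
    have "cinner x (y - a *\<^sub>C A y) = 0" for x
      using y[of x] by (simp add: cinner_simps assms sym)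
    then have "y + (- a) *\<^sub>C A y = 0"
      by (metis cinner_eq_zero_iff cvs.scale_minus_left diff_conv_add_uminus)
    moreover have "cnj (- a) = - (- a)" using assms by simp
    ultimately show "y = 0"
      using norm_le_imaginary_shift[of "- a" y]
      by (metis antisym cnorm_eq_zero cnorm_ge_zero cnorm_zero)
  qed (auto simp: csubspace_UNIV)
qed

lemma hdim_orth_compl_shift:
  assumes a: "cnj a = - a"
  shows "hdim (orth_compl ((\<lambda>x. x + a *\<^sub>C A x) ` R)) = hdim (orth_compl R)"
    (is "hdim (orth_compl (?M ` R)) = _")
proof -
  let ?N = "\<lambda>x. x + (- a) *\<^sub>C A x"
  have a': "cnj (- a) = - (- a)" using a by simp
  note bij = imaginary_shift_bij[OF a']
  have N: "bounded_clinear ?N"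
    by (intro bounded_clinear_plus bounded_clinear_ident bounded_clinear_scale bounded)
  have adj: "cinner (?M x) y = cinner x (?N y)" for x y
    by (simp add: cinner_simps a sym)
  then have mem: "x \<in> orth_compl (?M ` R) \<longleftrightarrow> ?N x \<in> orth_compl R" for x
    by (simp add: orth_compl_def)
  have invN: "bounded_clinear (inv ?N)"
  proof (rule bounded_clinearI[where K = 1])
    have N_inv: "?N (inv ?N x) = x" for x by (rule surj_f_inv_f[OF bij_is_surj[OF bij]])
    have inv_eq: "inv ?N x = z" if "?N z = x" for x z
      using that inv_f_f[OF bij_is_inj[OF bij]] by blast
    show "inv ?N (x + y) = inv ?N x + inv ?N y" for x y
      by (rule inv_eq) (simp only: bounded_clinear_add[OF N] N_inv)
    show "inv ?N (c *\<^sub>C x) = c *\<^sub>C inv ?N x" for c x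
      by (rule inv_eq) (simp only: bounded_clinear_scaleC[OF N] N_inv)
    show "cnorm (inv ?N x) \<le> 1 * cnorm x" for x
      using norm_le_imaginary_shift[OF a', of "inv ?N x"] N_inv[of x] by simp
  qed
  show ?thesis
  proof (rule antisym)
    show "hdim (orth_compl (?M ` R)) \<le> hdim (orth_compl R)"
      by (rule hdim_le_injective_image[OF N bij_is_inj[OF bij]])
        (use mem in \<open>auto simp: csubspace_orth_compl\<close>)
    show "hdim (orth_compl R) \<le> hdim (orth_compl (?M ` R))"
    proof (rule hdim_le_injective_image[OF invN])
      show "inj (inv ?N)" using bij bij_betw_imp_inj_on bij_imp_bij_inv by blast
      show "inv ?N ` orth_compl R \<subseteq> orth_compl (?M ` R)"
      proof
        fix y assume "y \<in> inv ?N ` orth_compl R"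
        then obtain x where "x \<in> orth_compl R" "y = inv ?N x" by blast
        then show "y \<in> orth_compl (?M ` R)"
          unfolding mem using surj_f_inv_f[OF bij_is_surj[OF bij], of x] by simp
      qed
    qed (rule csubspace_orth_compl)
  qed
qed

lemma deficiency_indices:
  assumes T: "\<And>y. y \<in> R \<Longrightarrow> T (A y) = y"
  shows "def_plus (A ` R) T = hdim (orth_compl R)" "def_minus (A ` R) T = hdim (orth_compl R)"
proof -
  have "(\<lambda>x. T x + \<i> *\<^sub>C x) ` (A ` R) = (\<lambda>y. y + \<i> *\<^sub>C A y) ` R"
    unfolding image_image by (rule image_cong) (simp_all add: T)
  then show "def_plus (A ` R) T = hdim (orth_compl R)"
    unfolding def_plus_def by (simp add: hdim_orth_compl_shift)
  have "(\<lambda>x. T x - \<i> *\<^sub>C x) ` (A ` R) = (\<lambda>y. y + (- \<i>) *\<^sub>C A y) ` R"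
    unfolding image_image by (rule image_cong) (simp_all add: T)
  then show "def_minus (A ` R) T = hdim (orth_compl R)"
    unfolding def_minus_def using hdim_orth_compl_shift[of "- \<i>" R] by simp
qed

text \<open>Used with the whole space to make the positive factor of a polar decomposition
  self-adjoint, and with an invariant subspace to exhibit a self-adjoint part that contradicts
  simplicity.\<close>

lemma selfadjoint_inverse:
  assumes J: "csubspace J" "cclosed J" and AJ: "A ` J \<subseteq> J" and T: "\<And>y. y \<in> J \<Longrightarrow> T (A y) = y"
  shows "op_selfadjoint_in J (A ` J) T"
  unfolding op_selfadjoint_in_def
proof (intro conjI ballI allI impI)
  show sub: "csubspace (A ` J)" by (rule csubspace_image[OF bounded J(1)])
  show "cdense_in (A ` J) J"
  proof (rule cdense_in_orthogonal[OF sub J AJ])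
    fix y assume y: "y \<in> J" "\<And>x. x \<in> A ` J \<Longrightarrow> cinner x y = 0"
    \<comment> \<open>The test vector \<open>A (A y)\<close> is available because \<open>A y\<close>
      again lies in \<open>J\<close>.\<close>
    then have "cinner (A (A y)) y = 0" using AJ by blast
    then have "cinner (A y) (A y) = 0" by (simp add: sym)
    then show "y = 0" using eq_zero by (simp add: cinner_eq_zero_iff)
  qed
  show "T ` A ` J \<subseteq> J" using T by auto
  show "T (x + y) = T x + T y" if "x \<in> A ` J" "y \<in> A ` J" for x y
    using that by (auto simp: T csubspace_add J simp flip: bounded_clinear_add[OF bounded])
  show "T (c *\<^sub>C x) = c *\<^sub>C T x" if "x \<in> A ` J" for c x
    using that by (auto simp: T csubspace_scaleC J simp flip: bounded_clinear_scaleC[OF bounded])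
  show "op_symmetric (A ` J) T" by (auto simp: op_symmetric_def T sym)
  fix y assume y: "y \<in> J" "\<exists>z\<in>J. \<forall>x\<in>A ` J. cinner (T x) y = cinner x z"
  then obtain z where z: "z \<in> J" "\<And>x. x \<in> J \<Longrightarrow> cinner x y = cinner x (A z)" by (auto simp: T sym)
  have "y - A z \<in> J" using y(1) z(1) AJ J(1) by (auto intro: csubspace_diff)
  then have "cinner (y - A z) (y - A z) = 0" using z(2)[of "y - A z"] by (simp add: cinner_diff_right)
  then have "y = A z" by (simp add: cinner_eq_zero_iff)
  then show "y \<in> A ` J" using z(1) by blast
qed (rule AJ)

text \<open>Density is where the Hankel property enters: a vector \<open>y\<close> orthogonal to all
  \<open>A (V x)\<close> satisfies \<open>A (V y) = 0\<close>. Closedness comes from the closed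
  range of \<open>V\<close>.\<close>

lemma hankel_restriction:
  assumes V: "is_isometry V" and H: "hankel V A"
  shows "csubspace (range (A \<circ> V))" "cdense (range (A \<circ> V))" "op_closed (range (A \<circ> V)) (inv A)"
    "op_symmetric (range (A \<circ> V)) (inv A)"
proof -
  note bV = isometry_bounded_clinear[OF V]
  have H': "cinner (V x) (A y) = cinner x (A (V y))" for x y using H hankel_iff[OF bV] by blast
  have bAV: "bounded_clinear (A \<circ> V)" unfolding o_def by (rule bounded_clinear_compose[OF bounded bV])
  show sub: "csubspace (range (A \<circ> V))" by (rule csubspace_image[OF bAV csubspace_UNIV])
  show "cdense (range (A \<circ> V))"
  proof (rule cdense_orthogonal[OF sub])
    fix y assume "\<And>x. x \<in> range (A \<circ> V) \<Longrightarrow> cinner x y = 0"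
    then have "cinner (A (V x)) y = 0" for x by auto
    then have "cinner x (A (V y)) = 0" for x by (simp add: sym H')
    then have "A (V y) = 0" by (metis cinner_eq_zero_iff)
    then have "V y = 0" by (rule eq_zero)
    then show "y = 0" using isometry_cnorm[OF V, of y] by (metis cnorm_eq_zero)
  qed
  show "op_symmetric (range (A \<circ> V)) (inv A)"
    by (auto simp: op_symmetric_def inv_f_f[OF inj] sym)
  show "op_closed (range (A \<circ> V)) (inv A)"
    unfolding op_closed_def
  proof (intro allI impI)
    fix X x y assume X: "\<forall>n. X n \<in> range (A \<circ> V)" "cconv X x" "cconv (\<lambda>n. inv A (X n)) y"
    have R: "inv A (X n) \<in> range V" and AX: "A (inv A (X n)) = X n" for n
      using X(1)[THEN spec, of n] by (auto simp: inv_f_f[OF inj])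
    then have y: "y \<in> range V"
      using cclosedD[OF isometry_closed_range[OF V] _ X(3)] by blast
    have "cconv X (A y)" using bounded_clinear_cconv[OF bounded X(3)] AX by simp
    then have "x = A y" using X(2) cconv_unique by blast
    then show "x \<in> range (A \<circ> V) \<and> inv A x = y" using y by (auto simp: inv_f_f[OF inj])
  qed
qed

lemma restriction_range:
  assumes D: "csubspace D" "op_restriction D T (range A) (inv A)"
  shows "T ` D = {y. A y \<in> D}" "A ` T ` D = D" "csubspace (T ` D)"
    "x \<in> D \<Longrightarrow> A (T x) = x" "y \<in> T ` D \<Longrightarrow> T (A y) = y"
proof -
  show AT: "A (T x) = x" if "x \<in> D" for x
    using D(2) that unfolding op_restriction_def by (metis f_inv_into_f subsetD)
  have TA: "T (A y) = y" if "A y \<in> D" for y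
    using D(2) that unfolding op_restriction_def by (simp add: inv_f_f[OF inj])
  show eq: "T ` D = {y. A y \<in> D}" using AT TA by force
  show "T (A y) = y" if "y \<in> T ` D" using that TA unfolding eq by blast
  show "A ` T ` D = D" using AT by force
  show "csubspace (T ` D)"
    unfolding eq using D(1) by (simp add: csubspace_def bounded_clinear_simps[OF bounded])
qed

text \<open>Since \<open>A\<close> is continuous, convergence of the values of \<open>T\<close>
  already forces convergence of the arguments, so a closed graph yields a closed range.\<close>

lemma closed_restriction_closed_range:
  assumes D: "csubspace D" "op_restriction D T (range A) (inv A)" "op_closed D T"
  shows "cclosed (T ` D)"
  unfolding cclosed_def
proof (intro allI impI)
  note R = restriction_range[OF D(1,2)]
  fix Y y assume Y: "\<forall>n. Y n \<in> T ` D" "cconv Y y"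
  have "A (Y n) \<in> D" "T (A (Y n)) = Y n" for n using Y(1) R(5) unfolding R(1) by auto
  then have "A y \<in> D"
    using D(3)[unfolded op_closed_def, rule_format, of "\<lambda>n. A (Y n)" "A y" y]
      bounded_clinear_cconv[OF bounded Y(2)] Y(2) by simp
  then show "y \<in> T ` D" unfolding R(1) by simp
qed

text \<open>With \<open>R\<close> the range of \<open>T\<close> and \<open>P\<close> the projection onto \<open>R\<close>, the inverse of \<open>\<bar>T\<bar>\<close> is
  \<open>S = sqrt (A P A)\<close>, and \<open>V\<close> extends \<open>S x \<mapsto> P (A x)\<close>.\<close>

lemma polar_part_exists:
  assumes D: "csubspace D" "op_restriction D T (range A) (inv A)" "cdense D" "op_closed D T"
  shows "\<exists>V. polar_part D T V"
proof -
  define R where "R = T ` D"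
  note r = restriction_range[OF D(1,2), folded R_def]
  have R: "csubspace R" "cclosed R"
    using r(3) closed_restriction_closed_range[OF D(1,2,4)] by (simp_all add: R_def)
  let ?P = "cproj R"
  note P = bounded_clinear_cproj[OF R] cproj_mem[OF R] cproj_ident[OF R] cproj_symmetric[OF R]
  have G: "bounded_clinear (\<lambda>x. ?P (A x))" by (rule bounded_clinear_compose[OF P(1) bounded])
  have PA: "cinner x (A (?P (A x))) = cinner (?P (A x)) (?P (A x))" for x
    using P(3)[OF P(2)] by (simp add: P(4) flip: sym)
  show ?thesis
  proof (rule positive_sqrt_exists[OF bounded_clinear_compose[OF bounded G]])
    show "cinner (A (?P (A x))) y = cinner x (A (?P (A y)))" for x y by (simp add: sym P(4))
    show "0 \<le> Re (cinner x (A (?P (A x))))" for x unfolding PA by (rule cinner_ge_zero)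
    fix S
    assume S: "bounded_clinear S" "\<And>x y. cinner (S x) y = cinner x (S y)"
      "\<And>x. 0 \<le> Re (cinner x (S x))" "\<And>x. S (S x) = A (?P (A x))"
    \<comment> \<open>Equality of these norms is what makes the assignment of
      \<open>?P (A x)\<close> to \<open>S x\<close> isometric.\<close>
    have norm: "cnorm (S x) = cnorm (?P (A x))" for x
      by (simp add: cnorm_def S(2,4) PA)
    have S0: "x = 0" if "S x = 0" for x
    proof (rule cdense_cinner_eq[OF D(3) UNIV_I UNIV_I csubspace_UNIV])
      have "?P (A x) = 0" using norm[of x] that by simp
      then have "cinner y (A x) = 0" if "y \<in> R" for y
        using cinner_cproj[OF R that, of "A x"] by simp
      then have "cinner (A y) x = 0" if "y \<in> R" for y using that by (simp add: sym)
      then show "cinner z x = cinner z 0" if "z \<in> D" for z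
        using that r(2) by (metis cinner_zero_right imageE)
    qed
    have Sdense: "cdense (range S)"
    proof (rule cdense_orthogonal[OF csubspace_image[OF S(1) csubspace_UNIV]])
      fix y assume "\<And>x. x \<in> range S \<Longrightarrow> cinner x y = 0"
      then have "cinner (S y) (S y) = 0" by (metis S(2) rangeI)
      then show "y = 0" using S0 by (simp add: cinner_eq_zero_iff)
    qed
    interpret S: injective_selfadjoint S
      using S(1,2) bounded_clinear_injI[OF S(1) S0] by unfold_locales
    show ?thesis
    proof (rule isometric_extension[OF S(1) G norm Sdense])
      fix V assume V: "is_isometry V" "\<And>x. V (S x) = ?P (A x)"
      note bV = isometry_bounded_clinear[OF V(1)]
      \<comment> \<open>On the range of \<open>S\<close> both sides equal
        \<open>A (?P (A u))\<close> for \<open>x = S u\<close>, and that range is dense.\<close>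
      have AV: "A (V x) = S x" for x
        by (rule bounded_clinear_eq_on_dense[OF bounded_clinear_compose[OF bounded bV] S(1) Sdense])
          (auto simp: V(2) S(4))
      have rV: "range V = R"
      proof (rule closed_subspace_eqI[OF csubspace_image[OF bV csubspace_UNIV] isometry_closed_range[OF V(1)] R(1)])
        show "range V \<subseteq> R"
        proof
          fix y assume "y \<in> range V"
          then obtain x where x: "y = V x" by blast
          obtain X where X: "\<And>n. X n \<in> range S" "cconv X x" using cdense_in_seq[OF Sdense UNIV_I] by blast
          have "V (X n) \<in> R" for n using X(1)[of n] V(2) P(2) by auto
          then show "y \<in> R"
            unfolding x by (rule cclosedD[OF R(2) _ bounded_clinear_cconv[OF bV X(2)]])
        qed
        fix y assume y: "y \<in> R" "\<And>x. x \<in> range V \<Longrightarrow> cinner x y = 0"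
        \<comment> \<open>Testing with \<open>V (S (A y)) = ?P (A (A y))\<close> and moving the
          projection onto \<open>y\<close>, which lies in \<open>R\<close>, leaves the squared norm
          of \<open>A y\<close>.\<close>
        then have "cinner (V (S (A y))) y = 0" by blast
        then have "cinner (A y) (A y) = 0" by (simp add: V(2) P(4) P(3)[OF y(1)] sym)
        then show "y = 0" using eq_zero by (simp add: cinner_eq_zero_iff)
      qed
      have "A ` range V = range S" unfolding image_image by (simp add: AV)
      then have DS: "D = range S" using rV r(2) by simp
      have V0: "V x = 0 \<longleftrightarrow> x = 0" for x using isometry_cnorm[OF V(1), of x] by (metis cnorm_eq_zero)
      have "op_selfadjoint D (inv S)"
        unfolding DS by (rule S.selfadjoint_inverse[OF csubspace_UNIV cclosed_UNIV])
          (simp_all add: inv_f_f[OF S.inj])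
      moreover have "op_positive D (inv S)"
        unfolding DS op_positive_def using S.cinner_real S(3)
        by (auto simp: inv_f_f[OF S.inj] S(2))
      moreover have "T x = V (inv S x)" if x: "x \<in> D" for x
      proof -
        obtain u where u: "x = S u" using x DS by blast
        have "T (A (V u)) = V u" using r(5)[of "V u"] rV by blast
        then show ?thesis by (simp add: u AV inv_f_f[OF S.inj])
      qed
      moreover have "{x. V x = 0} = {x \<in> D. T x = 0}"
      proof -
        have "T x = 0 \<longleftrightarrow> x = 0" if "x \<in> D" for x
          using r(4)[OF that] bounded_clinear_zero[OF bounded] eq_zero by metis
        then show ?thesis using V0 csubspace_zero[OF D(1)] by auto
      qed
      moreover have "partial_isometry V"
        using V(1) by (simp add: partial_isometry_def is_isometry_def)
      ultimately show ?thesis unfolding polar_part_def by blast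
    qed
  qed
qed

text \<open>As \<open>A\<close> inverts \<open>T\<close> and \<open>V\<close> is isometric, a bound
  for \<open>A\<close> bounds \<open>P\<close> from below; hence \<open>P\<close> is onto and
  \<open>A V\<close> is its inverse. Symmetry of that inverse is the Hankel property, and its
  positivity is recorded for the study of purity.\<close>

lemma polar_part_hankel:
  assumes D: "csubspace D" "op_restriction D T (range A) (inv A)" and V: "polar_part D T V"
  shows "is_isometry V" "hankel V A" "T ` D = range V" "0 \<le> Re (cinner x (A (V x)))"
proof -
  note r = restriction_range[OF D]
  obtain P where bV: "bounded_clinear V" and iso: "\<And>x. x \<in> orth_compl {y. V y = 0} \<Longrightarrow> cnorm (V x) = cnorm x"
    and ker: "{x. V x = 0} = {x \<in> D. T x = 0}"
    and P: "op_selfadjoint D P" "op_positive D P" "\<And>x. x \<in> D \<Longrightarrow> T x = V (P x)"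
    using V unfolding polar_part_def partial_isometry_def by blast
  \<comment> \<open>Injectivity of \<open>T\<close> makes the initial space of the partial isometry
    everything.\<close>
  have "{x. V x = 0} \<subseteq> {0}"
    unfolding ker using r(4) bounded_clinear_zero[OF bounded] by force
  then have "orth_compl {y. V y = 0} = UNIV" by (auto simp: orth_compl_def)
  then show V: "is_isometry V" using bV iso by (simp add: is_isometry_def)
  obtain K where K: "\<And>x. cnorm (A x) \<le> K * cnorm x" using bounded_clinear_bound[OF bounded] by blast
  have onto: "P ` D = UNIV"
  proof (rule selfadjoint_bounded_below_onto[OF P(1) csubspace_UNIV cclosed_UNIV])
    show "cnorm x \<le> K * cnorm (P x)" if "x \<in> D" for x
      using K[of "T x"] r(4)[OF that] P(3)[OF that] isometry_cnorm[OF V] by simp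
  qed
  have ex: "\<exists>d\<in>D. x = P d \<and> A (V x) = d" for x
  proof -
    obtain d where "d \<in> D" "x = P d" using onto by blast
    then show ?thesis using r(4) P(3) by metis
  qed
  show "T ` D = range V" using onto P(3) by (metis (no_types, lifting) image_cong image_image)
  have AV: "cinner (A (V x)) y = cinner x (A (V y))" for x y
  proof -
    obtain d e where "d \<in> D" "x = P d" "A (V x) = d" "e \<in> D" "y = P e" "A (V y) = e"
      using ex[of x] ex[of y] by blast
    then show ?thesis using P(1) unfolding op_selfadjoint_in_def op_symmetric_def by metis
  qed
  then show "hankel V A" unfolding hankel_iff[OF bV] by (simp flip: sym)
  show "0 \<le> Re (cinner x (A (V x)))"
  proof -
    obtain d where "d \<in> D" "x = P d" "A (V x) = d" using ex[of x] by blast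
    then show ?thesis using P(2) Re_cinner_commute unfolding op_positive_def by metis
  qed
qed

end

subsection \<open>Purity and simplicity\<close>

text \<open>Increments of a convex sequence do not decrease, so a positive first increment would
  force at least linear growth.\<close>

lemma bounded_convex_sequence_le:
  fixes a :: "nat \<Rightarrow> real"
  assumes convex: "\<And>n. 2 * a (Suc n) \<le> a n + a (Suc (Suc n))" and bound: "\<And>n. a n \<le> B"
  shows "a 1 \<le> a 0"
proof (rule ccontr)
  assume "\<not> a 1 \<le> a 0"
  then have d: "a 1 - a 0 > 0" by simp
  have step: "a 1 - a 0 \<le> a (Suc n) - a n" for n
  proof (induction n)
    case (Suc n)
    then show ?case using convex[of n] by simp
  qed simp
  have lower: "a 0 + real n * (a 1 - a 0) \<le> a n" for n
  proof (induction n)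
    case (Suc n)
    then show ?case using step[of n] by (simp add: algebra_simps)
  qed simp
  obtain n where "B - a 0 < real n * (a 1 - a 0)" using reals_Archimedean3[OF d] by blast
  then show False using bound[of n] lower[of n] by linarith
qed

text \<open>In the inner product induced by \<open>Q\<close> the isometry \<open>V\<close> is symmetric, and it is a contraction because
  the \<open>Q\<close>-norms along orbits are convex and bounded. On the unitary part of \<open>V\<close> this applies to the
  inverse as well, so there \<open>V\<close> is a self-adjoint unitary for \<open>Q\<close>.\<close>

lemma positive_hankel_involution:
  fixes V Q :: "'a::chilbert_space \<Rightarrow> 'a"
  assumes V: "is_isometry V"
    and Q: "bounded_clinear Q" "\<And>x y. cinner (Q x) y = cinner x (Q y)" "\<And>x. 0 \<le> Re (cinner x (Q x))"
    and Q0: "\<And>x. Q x = 0 \<Longrightarrow> x = 0"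
    and VQ: "\<And>x y. cinner (V x) (Q y) = cinner x (Q (V y))"
    and x: "x \<in> (\<Inter>n. range (V ^^ n))"
  shows "V (V x) = x"
proof -
  define q where "q x = Re (cinner x (Q x))" for x
  obtain K where K: "K > 0" "\<And>x. cnorm (Q x) \<le> K * cnorm x" using bounded_clinear_bound[OF Q(1)] by blast
  have bound: "q x \<le> K * (cnorm x)\<^sup>2" for x
    using Re_cinner_le[of x "Q x"] mult_left_mono[OF K(2)[of x] cnorm_ge_zero[of x]]
    by (simp add: q_def power2_eq_square mult.left_commute)
  \<comment> \<open>The cross term is \<open>q (V x)\<close>, because one \<open>V\<close> can be
    moved across the form of \<open>Q\<close>. Positivity of \<open>q\<close> thereby becomes
    convexity along orbits.\<close>
  have q_diff: "q (x - V (V x)) = q x + q (V (V x)) - 2 * q (V x)" for x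
    using VQ[of x "V x"] Re_cinner_commute[of x "Q (V (V x))"]
    by (simp add: q_def bounded_clinear_diff[OF Q(1)] cinner_simps Q(2))
  have q_pos: "0 \<le> q x" for x unfolding q_def by (rule Q(3))
  have convex: "2 * q (V x) \<le> q x + q (V (V x))" for x
    using q_pos[of "x - V (V x)"] by (simp add: q_diff)
  have forward: "q (V x) \<le> q x" for x
  proof -
    have "cnorm ((V ^^ n) x) = cnorm x" for n by (induction n) (simp_all add: isometry_cnorm[OF V])
    then have "q ((V ^^ n) x) \<le> K * (cnorm x)\<^sup>2" for n by (metis bound)
    then show ?thesis
      using bounded_convex_sequence_le[of "\<lambda>n. q ((V ^^ n) x)" "K * (cnorm x)\<^sup>2"] convex by simp
  qed
  have "\<forall>n. \<exists>y. x = (V ^^ n) y" using x by auto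
  \<comment> \<open>The preimages of \<open>x\<close> under the powers of \<open>V\<close> are
    chosen independently; injectivity of the powers makes them one backward orbit.\<close>
  then obtain y where y: "\<And>n. x = (V ^^ n) (y n)" by metis
  have Vy: "V (y (Suc n)) = y n" for n
  proof -
    have "(V ^^ n) (V (y (Suc n))) = (V ^^ n) (y n)"
      using y[of n] y[of "Suc n"] by (simp add: funpow_swap1)
    then show ?thesis using inj_fn[OF isometry_inj[OF V], of n] by (metis injD)
  qed
  have ny: "cnorm (y n) = cnorm x" for n
    using y[of 0] Vy isometry_cnorm[OF V] by (induction n) (simp, metis)
  \<comment> \<open>The backward orbit is also convex and bounded, which reverses the
    \<open>forward\<close> inequality; so \<open>q\<close> is constant along it.\<close>
  have "q (y (Suc k)) \<le> q (y k)" for k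
    using bounded_convex_sequence_le[of "\<lambda>n. q (y (n + k))" "K * (cnorm x)\<^sup>2"]
      convex[of "y (Suc (Suc n + k))" for n] bound[of "y n" for n] Vy
    by (simp add: ny add.commute)
  moreover have "q (y k) \<le> q (y (Suc k))" for k using forward[of "y (Suc k)"] Vy[of k] by simp
  ultimately have "q (y (Suc k)) = q (y k)" for k by (metis antisym)
  \<comment> \<open>With \<open>q\<close> constant the right side of \<open>q_diff\<close> vanishes
    at \<open>y 2\<close>, whose image under \<open>V\<close> twice is
    \<open>y 0 = x\<close>.\<close>
  then have "q (y 2 - y 0) = 0"
    using q_diff[of "y 2"] Vy[of 0] Vy[of 1] by (simp add: numeral_2_eq_2)
  then have "Q (y 2 - y 0) = 0" by (intro positive_eq_zero[OF Q]) (simp add: q_def)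
  then have "y 2 - y 0 = 0" by (rule Q0)
  then show ?thesis using y[of 0] Vy[of 0] Vy[of 1] by (simp add: numeral_2_eq_2)
qed

context injective_selfadjoint
begin

text \<open>The fixed space \<open>J\<close> of \<open>V\<close> applied twice contains the unitary
  part and is invariant under \<open>A\<close>, so a nonzero \<open>J\<close> would carry a
  self-adjoint part of \<open>T\<close>.\<close>

lemma simple_imp_pure:
  assumes V: "is_isometry V" and H: "hankel V A" and pos: "\<And>x. 0 \<le> Re (cinner x (A (V x)))"
    and simple: "op_simple (A ` range V) T" and T: "\<And>y. y \<in> range V \<Longrightarrow> T (A y) = y"
  shows "is_pure V"
proof (rule ccontr)
  assume np: "\<not> is_pure V"
  note bV = isometry_bounded_clinear[OF V]
  have H': "cinner (V x) (A y) = cinner x (A (V y))" for x y using H hankel_iff[OF bV] by blast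
  have V0: "x = 0" if "V x = 0" for x using isometry_cnorm[OF V, of x] that by (metis cnorm_eq_zero)
  have bVV: "bounded_clinear (\<lambda>x. V (V x))" by (rule bounded_clinear_compose[OF bV bV])
  define J where "J = {x. V (V x) = x}"
  have J: "csubspace J" by (simp add: J_def csubspace_def bounded_clinear_simps[OF bV])
  have Jcl: "cclosed J"
    unfolding cclosed_def
  proof (intro allI impI)
    fix X L assume X: "\<forall>n. X n \<in> J" "cconv X L"
    then have "cconv X (V (V L))" using bounded_clinear_cconv[OF bVV X(2)] by (simp add: J_def)
    then have "V (V L) = L" by (rule cconv_unique) (rule X(2))
    then show "L \<in> J" by (simp add: J_def)
  qed
  have JV: "J \<subseteq> range V" unfolding J_def by (metis (mono_tags) mem_Collect_eq rangeI subsetI)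
  have AJ: "A ` J \<subseteq> J"
  proof
    fix y assume "y \<in> A ` J"
    then obtain x where x: "x \<in> J" "y = A x" by blast
    \<comment> \<open>Both copies of \<open>V\<close> move onto \<open>x\<close>, which they fix.
      Since \<open>V (V y)\<close> and \<open>y\<close> have equal norms, this inner product forces
      them to coincide.\<close>
    have "cinner (V (V y)) y = cinner y y" using x by (simp add: H' J_def)
    then have "(cnorm (V (V y) - y))\<^sup>2 = 0"
      by (simp add: cnorm_diff_sq isometry_cnorm[OF V] flip: cnorm_sq)
    then show "y \<in> J" by (simp add: J_def)
  qed
  have "op_selfadjoint_in J (A ` J) T"
    using selfadjoint_inverse[OF J Jcl AJ] T JV by blast
  moreover have "A ` J \<subseteq> A ` range V" using JV by blast
  ultimately have "J = {0}" using simple J Jcl unfolding op_simple_def by blast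
  moreover have "x \<in> J" if "x \<in> (\<Inter>n. range (V ^^ n))" for x
    unfolding J_def mem_Collect_eq
  proof (rule positive_hankel_involution[OF V _ _ pos _ _ that])
    show "bounded_clinear (\<lambda>x. A (V x))" by (rule bounded_clinear_compose[OF bounded bV])
    show "x = 0" if "A (V x) = 0" for x using eq_zero V0 that by blast
  qed (simp_all add: sym H')
  moreover have "0 \<in> range (V ^^ n)" for n
  proof -
    have "(V ^^ n) 0 = 0" by (induction n) (simp_all add: bounded_clinear_zero[OF bV])
    then show ?thesis by (metis rangeI)
  qed
  ultimately have "(\<Inter>n. range (V ^^ n)) = {0}" by blast
  then show False using np unfolding is_pure_def by blast
qed

lemma pure_imp_simple:
  assumes V: "is_isometry V" and H: "hankel V A" and pure: "is_pure V"
    and pos: "\<And>x. 0 \<le> Re (cinner x (A (V x)))"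
  shows "op_simple (range (A \<circ> V)) (inv A)"
  unfolding op_simple_def
proof
  assume "\<exists>J E. csubspace J \<and> cclosed J \<and> J \<noteq> {0} \<and> E \<subseteq> range (A \<circ> V) \<and> op_selfadjoint_in J E (inv A)"
  then obtain J E where J: "csubspace J" "cclosed J" "J \<noteq> {0}" and E: "E \<subseteq> range (A \<circ> V)"
    and sa: "op_selfadjoint_in J E (inv A)" by blast
  note bV = isometry_bounded_clinear[OF V]
  have H': "cinner (V x) (A y) = cinner x (A (V y))" for x y using H hankel_iff[OF bV] by blast
  have EJ: "E \<subseteq> J" "cdense_in E J" using sa unfolding op_selfadjoint_in_def by blast+
  have AE: "A (inv A x) = x" "inv A x \<in> range V" if "x \<in> E" for x
    using E that by (auto simp: inv_f_f[OF inj])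
  obtain K where K: "\<And>x. cnorm (A x) \<le> K * cnorm x" using bounded_clinear_bound[OF bounded] by blast
  have onto: "inv A ` E = J"
    by (rule selfadjoint_bounded_below_onto[OF sa J(1,2), of K]) (metis AE(1) K)
  have JV: "x \<in> range V" and AJ: "A x \<in> E" if "x \<in> J" for x
    using that AE unfolding onto[symmetric] by auto
  \<comment> \<open>On \<open>J\<close> the vector \<open>A x\<close> lies in the range of
    \<open>V\<close>, and by the Hankel property its preimage under \<open>V\<close> is
    \<open>A (V x)\<close>.\<close>
  have VQ: "V (A (V x)) = A x" if x: "x \<in> J" for x
  proof -
    obtain u where u: "A x = V u" using JV AJ[OF x] EJ(1) by blast
    have "A (V x) = u"
    proof (rule cinner_ext)
      show "cinner z (A (V x)) = cinner z u" for z
        using H'[of z x] isometry_cinner[OF V, of z u] u by simp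
    qed
    then show ?thesis using u by simp
  qed
  \<comment> \<open>By \<open>VQ\<close> the square of \<open>A V\<close> acts on \<open>J\<close>
    as the square of \<open>A\<close>, which preserves \<open>J\<close>; positivity passes the
    invariance to \<open>A V\<close> itself.\<close>
  have Q: "A (V x) \<in> J" if x: "x \<in> J" for x
  proof (rule positive_invariant_subspace[OF _ _ pos J(1,2) _ x])
    show "bounded_clinear (\<lambda>x. A (V x))" by (rule bounded_clinear_compose[OF bounded bV])
    show "A (V (A (V x))) \<in> J" if "x \<in> J" for x
      using VQ[OF that] AJ EJ(1) that by auto
  qed (simp add: sym H')
  have "cclosed (V ` J)"
    by (rule bounded_below_closed_image[OF bV _ J(2), of 1]) (simp add: isometry_cnorm[OF V])
  moreover have "E \<subseteq> V ` J" using onto AE(1) VQ Q by (metis imageI subsetI)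
  \<comment> \<open>\<open>V\<close>
    J\<open>is closed and contains\<close>E\<open>, which is dense in\<close>J\<open>. Iterating\<close>J
    \<subseteq> V \<open>J\<close> then puts \<open>J\<close> into the range of every power of
    \<open>V\<close>.\<close>
  ultimately have JVJ: "x \<in> V ` J" if "x \<in> J" for x
    using cdense_in_seq[OF EJ(2) that] unfolding cclosed_def by (metis subsetD)
  have "\<exists>y\<in>J. x = (V ^^ n) y" if "x \<in> J" for x n
  proof (induction n)
    case (Suc n)
    then obtain y where y: "y \<in> J" "x = (V ^^ n) y" by blast
    obtain z where "z \<in> J" "y = V z" using JVJ[OF y(1)] by blast
    then show ?case using y(2) by (auto simp: funpow_swap1)
  qed (use that in auto)
  then have "J \<subseteq> (\<Inter>n. range (V ^^ n))" by blast
  then show False using pure J(1,3) csubspace_zero[OF J(1)] unfolding is_pure_def by blast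
qed

end

section \<open>Hankel isometries and closed symmetric restrictions of the inverse\<close>

theorem theoremD:
  fixes A :: "'a::chilbert_space \<Rightarrow> 'a" and N :: enat
  assumes sep: "cseparable TYPE('a)"
    and bA: "bounded_clinear A" and saA: "cadj A = A"
    and injA: "inj A" and ninv: "\<not> cinvertible A"
  shows
   "((\<exists>V. is_isometry V \<and> pure_mult V = N \<and> hankel V A) \<longleftrightarrow>
      (\<exists>D T. csubspace D \<and> op_restriction D T (range A) (inv A) \<and> cdense D \<and>
             op_closed D T \<and> op_symmetric D T \<and> def_plus D T = N \<and> def_minus D T = N))
  \<and> (\<forall>V. is_isometry V \<and> pure_mult V = N \<and> hankel V A \<longrightarrow>
        csubspace (range (A \<circ> V)) \<and> op_restriction (range (A \<circ> V)) (inv A) (range A) (inv A) \<and>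
        cdense (range (A \<circ> V)) \<and> op_closed (range (A \<circ> V)) (inv A) \<and>
        op_symmetric (range (A \<circ> V)) (inv A) \<and>
        def_plus (range (A \<circ> V)) (inv A) = N \<and> def_minus (range (A \<circ> V)) (inv A) = N \<and>
        inv A ` range (A \<circ> V) = range V)
  \<and> (\<forall>D T. csubspace D \<and> op_restriction D T (range A) (inv A) \<and> cdense D \<and>
           op_closed D T \<and> op_symmetric D T \<and> def_plus D T = N \<and> def_minus D T = N \<longrightarrow>
        (\<exists>V. polar_part D T V) \<and>
        (\<forall>V. polar_part D T V \<longrightarrow>
             is_isometry V \<and> pure_mult V = N \<and> hankel V A \<and> T ` D = range V \<and>
             (op_simple D T \<and> N > 0 \<longrightarrow> is_pure V)))
  \<and> (\<forall>V. is_isometry V \<and> hankel V A \<and> is_pure V \<and> strictly_pos (A \<circ> V) \<longrightarrow>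
        op_simple (range (A \<circ> V)) (inv A))"
proof -
  interpret injective_selfadjoint A
    using bA injA cadj[OF bA] saA by unfold_locales auto
  have i: "csubspace (range (A \<circ> V)) \<and> op_restriction (range (A \<circ> V)) (inv A) (range A) (inv A) \<and>
        cdense (range (A \<circ> V)) \<and> op_closed (range (A \<circ> V)) (inv A) \<and>
        op_symmetric (range (A \<circ> V)) (inv A) \<and>
        def_plus (range (A \<circ> V)) (inv A) = N \<and> def_minus (range (A \<circ> V)) (inv A) = N \<and>
        inv A ` range (A \<circ> V) = range V"
    if "is_isometry V" "pure_mult V = N" "hankel V A" for V
  proof -
    have "op_restriction (range (A \<circ> V)) (inv A) (range A) (inv A)" by (auto simp: op_restriction_def)
    moreover have "inv A ` range (A \<circ> V) = range V" by (simp add: image_image inv_f_f[OF injA])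
    moreover have "def_plus (range (A \<circ> V)) (inv A) = N" "def_minus (range (A \<circ> V)) (inv A) = N"
      using deficiency_indices[of "range V" "inv A"] that(2)
      by (simp_all add: pure_mult_def inv_f_f[OF injA] image_comp)
    ultimately show ?thesis using hankel_restriction[OF that(1,3)] by blast
  qed
  have ii: "is_isometry V \<and> pure_mult V = N \<and> hankel V A \<and> T ` D = range V \<and> (op_simple D T \<longrightarrow> is_pure V)"
    if D: "csubspace D" "op_restriction D T (range A) (inv A)" and N: "def_plus D T = N"
      and V: "polar_part D T V" for D T V
  proof -
    note p = polar_part_hankel[OF D V] and r = restriction_range[OF D]
    have D': "D = A ` range V" using r(2) p(3) by simp
    have T: "T (A y) = y" if "y \<in> range V" for y using r(5) p(3) that by blast
    have "pure_mult V = N"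
      using deficiency_indices(1)[of "range V" T, OF T] N unfolding pure_mult_def D'[symmetric] by simp
    moreover have "is_pure V" if "op_simple D T"
      using simple_imp_pure[OF p(1,2,4) _ T] that unfolding D'[symmetric] by blast
    ultimately show ?thesis using p by blast
  qed
  have iii: "op_simple (range (A \<circ> V)) (inv A)"
    if "is_isometry V" "hankel V A" "is_pure V" "strictly_pos (A \<circ> V)" for V
    using pure_imp_simple[OF that(1-3)] that(4) by (simp add: strictly_pos_def)
  show ?thesis
  proof (intro conjI)
    show "(\<exists>V. is_isometry V \<and> pure_mult V = N \<and> hankel V A) \<longleftrightarrow>
      (\<exists>D T. csubspace D \<and> op_restriction D T (range A) (inv A) \<and> cdense D \<and>
             op_closed D T \<and> op_symmetric D T \<and> def_plus D T = N \<and> def_minus D T = N)" (is "?L \<longleftrightarrow> ?R")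
    proof
      assume ?L
      then obtain V where "is_isometry V" "pure_mult V = N" "hankel V A" by blast
      from i[OF this] show ?R by (intro exI[of _ "range (A \<circ> V)"] exI[of _ "inv A"]) blast
    next
      assume ?R
      then obtain D T where D: "csubspace D" "op_restriction D T (range A) (inv A)" "cdense D"
        "op_closed D T" "def_plus D T = N" by blast
      obtain V where "polar_part D T V" using polar_part_exists[OF D(1-4)] by blast
      from ii[OF D(1,2,5) this] show ?L by blast
    qed
  qed (use i in blast, use ii polar_part_exists in blast, use iii in blast)
qed

end
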